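(* Let $p$ be a prime and $(G,\theta)$ a $p$-oriented profinite group. Then $(G,\theta)$ satisfies formal Hilbert 90 if and only if it admits a Hilbert 90 module.
   Context: A $p$-oriented profinite group is a pair $(G,\theta)$ with $G$ a profinite group and $\theta\colon G\to\mathbb Z_p^\times$ a continuous homomorphism. For $n\geq 1$, $\mathbb Z/p^n\mathbb Z(1)$ denotes the discrete $G$-module $\mathbb Z/p^n\mathbb Z$ with $g\cdot v=\theta(g)v$. $(G,\theta)$ satisfies formal Hilbert 90 if for every open subgroup $H\subset G$ and every $n\geq1$ the reduction map $H^1(H,\mathbb Z/p^n\mathbb Z(1))\to H^1(H,\mathbb Z/p\mathbb Z(1))$ is surjective. Let $S$ be the discrete $G$-module with underlying group $\mathbb Q/\mathbb Z_{(p)}$ on which $g\in G$ acts by multiplication by $\theta(g)$. A Hilbert 90 module for $(G,\theta)$ is a discrete $G$-module $M$ such that (i) $pM=M$, (ii) the $p$-primary torsion subgroup $M\{p\}$ is isomorphic to $S$ as a $G$-module, and (iii) $H^1(H,M)=0$ for every open subgroup $H\subset G$. *)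

theory Defs
  imports "HOL-Computational_Algebra.Primes" "HOL-Algebra.Group" "HOL-Analysis.T1_Spaces" "HOL-Analysis.Product_Topology"
begin

definition totally_disconnected_space :: "'a topology \<Rightarrow> bool" where
  "totally_disconnected_space T \<longleftrightarrow> (\<forall>C. connectedin T C \<longrightarrow> C = {} \<or> (\<exists>a. C = {a}))"

definition topological_group :: "('g, 'b) monoid_scheme \<Rightarrow> 'g topology \<Rightarrow> bool" where
  "topological_group G T \<longleftrightarrow> group G \<and> topspace T = carrier G
     \<and> continuous_map (prod_topology T T) T (\<lambda>(x, y). x \<otimes>\<^bsub>G\<^esub> y)
     \<and> continuous_map T T (\<lambda>x. inv\<^bsub>G\<^esub> x)"

definition profinite_group :: "('g, 'b) monoid_scheme \<Rightarrow> 'g topology \<Rightarrow> bool" where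
  "profinite_group G T \<longleftrightarrow> topological_group G T \<and> compact_space T \<and> Hausdorff_space T
     \<and> totally_disconnected_space T"

definition open_subgroup :: "('g, 'b) monoid_scheme \<Rightarrow> 'g topology \<Rightarrow> 'g set \<Rightarrow> bool" where
  "open_subgroup G T H \<longleftrightarrow> subgroup H G \<and> openin T H"

text \<open>An element of Z_p = lim Z/p^n, represented as the compatible sequence of its residues
  x n in {0..<p^n}.\<close>
definition padic_int :: "int \<Rightarrow> (nat \<Rightarrow> int) \<Rightarrow> bool" where
  "padic_int p x \<longleftrightarrow> (\<forall>n. 0 \<le> x n \<and> x n < p ^ n \<and> x (Suc n) mod p ^ n = x n)"

definition padic_unit :: "int \<Rightarrow> (nat \<Rightarrow> int) \<Rightarrow> bool" where
  "padic_unit p x \<longleftrightarrow> padic_int p x \<and> x 1 \<noteq> 0"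

text \<open>A continuous homomorphism theta : G -> Z_p^x.  Multiplication in Z_p is coordinatewise
  modulo p^n; the topology of Z_p is the inverse limit topology, so continuity means that
  every coordinate g |-> theta g n is locally constant.\<close>
definition p_orientation ::
  "int \<Rightarrow> ('g, 'b) monoid_scheme \<Rightarrow> 'g topology \<Rightarrow> ('g \<Rightarrow> nat \<Rightarrow> int) \<Rightarrow> bool" where
  "p_orientation p G T \<theta> \<longleftrightarrow>
     (\<forall>g\<in>carrier G. padic_unit p (\<theta> g))
   \<and> (\<forall>g\<in>carrier G. \<forall>h\<in>carrier G. \<forall>n. \<theta> (g \<otimes>\<^bsub>G\<^esub> h) n = (\<theta> g n * \<theta> h n) mod p ^ n)
   \<and> (\<forall>n a. openin T {g \<in> carrier G. \<theta> g n = a})"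

definition discrete_module ::
  "('g, 'b) monoid_scheme \<Rightarrow> 'g topology \<Rightarrow> ('m, 'c) monoid_scheme \<Rightarrow> ('g \<Rightarrow> 'm \<Rightarrow> 'm) \<Rightarrow> bool" where
  "discrete_module G T M act \<longleftrightarrow> comm_group M
   \<and> (\<forall>g\<in>carrier G. \<forall>m\<in>carrier M. act g m \<in> carrier M)
   \<and> (\<forall>m\<in>carrier M. act \<one>\<^bsub>G\<^esub> m = m)
   \<and> (\<forall>g\<in>carrier G. \<forall>h\<in>carrier G. \<forall>m\<in>carrier M. act (g \<otimes>\<^bsub>G\<^esub> h) m = act g (act h m))
   \<and> (\<forall>g\<in>carrier G. \<forall>m\<in>carrier M. \<forall>m'\<in>carrier M.
        act g (m \<otimes>\<^bsub>M\<^esub> m') = act g m \<otimes>\<^bsub>M\<^esub> act g m')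
   \<and> (\<forall>m\<in>carrier M. openin T {g \<in> carrier G. act g m = m})"

text \<open>Continuous 1-cocycles (crossed homomorphisms) H -> M, M discrete (continuity = local
  constancy), and 1-coboundaries.  H^1(H,M) is the quotient of the former by the latter.\<close>
definition cocycle1 ::
  "('g, 'b) monoid_scheme \<Rightarrow> 'g topology \<Rightarrow> 'g set \<Rightarrow> ('m, 'c) monoid_scheme
     \<Rightarrow> ('g \<Rightarrow> 'm \<Rightarrow> 'm) \<Rightarrow> ('g \<Rightarrow> 'm) \<Rightarrow> bool" where
  "cocycle1 G T H M act f \<longleftrightarrow>
     (\<forall>h\<in>H. f h \<in> carrier M)
   \<and> (\<forall>h\<in>H. \<forall>k\<in>H. f (h \<otimes>\<^bsub>G\<^esub> k) = f h \<otimes>\<^bsub>M\<^esub> act h (f k))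
   \<and> (\<forall>m. openin T {h \<in> H. f h = m})"

definition coboundary1 ::
  "'g set \<Rightarrow> ('m, 'c) monoid_scheme \<Rightarrow> ('g \<Rightarrow> 'm \<Rightarrow> 'm) \<Rightarrow> ('g \<Rightarrow> 'm) \<Rightarrow> bool" where
  "coboundary1 H M act f \<longleftrightarrow>
     (\<exists>m\<in>carrier M. \<forall>h\<in>H. f h = act h m \<otimes>\<^bsub>M\<^esub> inv\<^bsub>M\<^esub> m)"

definition H1_vanishes ::
  "('g, 'b) monoid_scheme \<Rightarrow> 'g topology \<Rightarrow> 'g set \<Rightarrow> ('m, 'c) monoid_scheme
     \<Rightarrow> ('g \<Rightarrow> 'm \<Rightarrow> 'm) \<Rightarrow> bool" where
  "H1_vanishes G T H M act \<longleftrightarrow> (\<forall>f. cocycle1 G T H M act f \<longrightarrow> coboundary1 H M act f)"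

definition Zmod :: "int \<Rightarrow> nat \<Rightarrow> int monoid" where
  "Zmod p n = \<lparr>carrier = {0..<p ^ n}, monoid.mult = (\<lambda>a b. (a + b) mod p ^ n), one = 0\<rparr>"

definition Zmod_act :: "int \<Rightarrow> nat \<Rightarrow> ('g \<Rightarrow> nat \<Rightarrow> int) \<Rightarrow> 'g \<Rightarrow> int \<Rightarrow> int" where
  "Zmod_act p n \<theta> g v = (\<theta> g n * v) mod p ^ n"

text \<open>Formal Hilbert 90: for every open subgroup H and n >= 1, the reduction map
  H^1(H, Z/p^n(1)) -> H^1(H, Z/p(1)) (induced by v |-> v mod p) is surjective, i.e. every
  cocycle class in H^1(H,Z/p(1)) is the class of the reduction of some cocycle.\<close>
definition formal_H90 ::
  "int \<Rightarrow> ('g, 'b) monoid_scheme \<Rightarrow> 'g topology \<Rightarrow> ('g \<Rightarrow> nat \<Rightarrow> int) \<Rightarrow> bool" where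
  "formal_H90 p G T \<theta> \<longleftrightarrow>
    (\<forall>H n. open_subgroup G T H \<and> n \<ge> 1 \<longrightarrow>
      (\<forall>c. cocycle1 G T H (Zmod p 1) (Zmod_act p 1 \<theta>) c \<longrightarrow>
        (\<exists>c'. cocycle1 G T H (Zmod p n) (Zmod_act p n \<theta>) c'
            \<and> coboundary1 H (Zmod p 1) (Zmod_act p 1 \<theta>) (\<lambda>h. (c' h - c h) mod p))))"

definition Zloc :: "int \<Rightarrow> rat set" where
  "Zloc p = {q. \<exists>a b. b \<noteq> 0 \<and> \<not> p dvd b \<and> q = of_int a / of_int b}"

definition S_carrier :: "int \<Rightarrow> rat set set" where
  "S_carrier p = {A. \<exists>q. A = {w. \<exists>z\<in>Zloc p. w = q + z}}"

definition S_add :: "rat set \<Rightarrow> rat set \<Rightarrow> rat set" where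
  "S_add A B = {w. \<exists>a\<in>A. \<exists>b\<in>B. w = a + b}"

definition S_grp :: "int \<Rightarrow> rat set monoid" where
  "S_grp p = \<lparr>carrier = S_carrier p, monoid.mult = S_add, one = Zloc p\<rparr>"

text \<open>theta(g) acts on the class of r: choose N with p^N r in Z_(p); then theta(g) r is
  congruent mod Z_(p) to (theta(g) mod p^N) * r.\<close>
definition S_act :: "int \<Rightarrow> ('g \<Rightarrow> nat \<Rightarrow> int) \<Rightarrow> 'g \<Rightarrow> rat set \<Rightarrow> rat set" where
  "S_act p \<theta> g A = {w. \<exists>q\<in>A. \<exists>k::nat. \<exists>z\<in>Zloc p.
                        of_int (p ^ k) * q \<in> Zloc p \<and> w = of_int (\<theta> g k) * q + z}"

definition p_primary :: "int \<Rightarrow> ('m, 'c) monoid_scheme \<Rightarrow> 'm set" where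
  "p_primary p M = {m \<in> carrier M. \<exists>n::nat. m [^]\<^bsub>M\<^esub> (nat p ^ n) = \<one>\<^bsub>M\<^esub>}"

definition H90_module ::
  "int \<Rightarrow> ('g, 'b) monoid_scheme \<Rightarrow> 'g topology \<Rightarrow> ('g \<Rightarrow> nat \<Rightarrow> int)
     \<Rightarrow> ('m, 'c) monoid_scheme \<Rightarrow> ('g \<Rightarrow> 'm \<Rightarrow> 'm) \<Rightarrow> bool" where
  "H90_module p G T \<theta> M act \<longleftrightarrow> discrete_module G T M act
   \<and> (\<forall>m\<in>carrier M. \<exists>x\<in>carrier M. x [^]\<^bsub>M\<^esub> (nat p) = m)
   \<and> (\<exists>\<phi>. bij_betw \<phi> (p_primary p M) (carrier (S_grp p))
        \<and> (\<forall>x\<in>p_primary p M. \<forall>y\<in>p_primary p M. \<phi> (x \<otimes>\<^bsub>M\<^esub> y) = \<phi> x \<otimes>\<^bsub>S_grp p\<^esub> \<phi> y)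
        \<and> (\<forall>g\<in>carrier G. \<forall>x\<in>p_primary p M. \<phi> (act g x) = S_act p \<theta> g (\<phi> x)))
   \<and> (\<forall>H. open_subgroup G T H \<longrightarrow> H1_vanishes G T H M act)"

end

theory Submission
  imports Defs "HOL-Library.Equipollence" "HOL-Library.Function_Algebras"
    "HOL-Analysis.Finite_Cartesian_Product"
begin

text \<open>
  If \<open>M\<close> is a Hilbert 90 module, a cocycle \<open>c\<close> with values in \<open>\<int>/p(1) = M[p]\<close> is the coboundary of some
  \<open>m\<close>; writing \<open>m = p\<^sup>n\<^sup>-\<^sup>1 m'\<close>, the coboundary of \<open>m'\<close> takes values in \<open>M[p\<^sup>n] = \<int>/p\<^sup>n(1)\<close>
  and lifts \<open>c\<close>.

  Conversely, formal Hilbert 90 makes the group of continuous cocycles \<open>H \<rightarrow> S\<close> divisible by \<open>p\<close> for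
  every open \<open>H\<close>, so each cocycle \<open>c\<close> extends to a tower \<open>c = c\<^sub>0, c\<^sub>1, \<dots>\<close> with \<open>p c\<^sub>i\<^sub>+\<^sub>1 = c\<^sub>i\<close>.
  Let \<open>B\<close> be the limit of \<open>S \<leftarrow> S \<leftarrow> \<dots>\<close> along multiplication by \<open>p\<close>, a rational vector space on which
  \<open>G\<close> acts through \<open>\<theta>\<close>.  The tower is the coboundary of the coinduced function \<open>F : G \<rightarrow> B\<close>,
  \<open>F (x) = r c(r\<^sup>-\<^sup>1 x)\<close> with \<open>r\<close> a representative of \<open>x H\<close>.  All these functions \<open>F\<close>,
  together with the functions \<open>x \<mapsto> \<theta>(x) b\<close>, generate under translation, division by \<open>p\<close> and
  \<open>\<int>\<^sub>(\<^sub>p\<^sub>)\<close>-linear combination a module; modulo the functions \<open>x \<mapsto> \<theta>(x) b\<close> with \<open>b\<^sub>0 = 0\<close> it is the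
  Hilbert 90 module.  Its \<open>p\<close>-primary torsion consists of the classes of \<open>x \<mapsto> \<theta>(x) b\<close>, which is \<open>S\<close>; a cocycle
  with values in the module becomes \<open>S\<close>-valued after averaging over the cosets of its kernel, and is then a
  coboundary by construction.  Taking only generated functions, rather than all functions with
  these properties, keeps the module countable when \<open>G\<close> is finite.
\<close>

section \<open>Cardinality\<close>

lemma lepoll_Times_infinite:
  assumes "infinite (U :: 'u set)" "A \<lesssim> U" "B \<lesssim> U"
  shows "A \<times> B \<lesssim> U"
proof -
  have "U \<times> U \<approx> U"
    using card_of_Times_same_infinite[OF assms(1)] by (simp add: eqpoll_iff_card_of_ordIso)
  then show ?thesis
    using times_lepoll_mono[OF assms(2,3)] lepoll_trans2 by blast
qed

lemma countable_lepoll_infinite: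
  assumes "countable A" "infinite U"
  shows "A \<lesssim> U"
proof -
  have "A \<lesssim> (UNIV :: nat set)"
    using assms(1) by (auto simp: lepoll_def countable_def)
  then show ?thesis
    using assms(2) infinite_le_lepoll lepoll_trans by blast
qed

text \<open>A pairing map on \<open>U\<close> folds a list into one element of \<open>U\<close>. The
  fold is injective on lists of a fixed length, so the length is recorded alongside it.\<close>

lemma lists_lepoll_infinite:
  assumes "infinite (U :: 'u set)"
  shows "lists U \<lesssim> U"
proof -
  obtain pr where pr: "inj_on pr (U \<times> U)" "pr ` (U \<times> U) \<subseteq> U"
    using lepoll_Times_infinite[OF assms lepoll_refl lepoll_refl] unfolding lepoll_def by blast
  obtain u where u: "u \<in> U"
    using infinite_imp_nonempty[OF assms] by blast
  define enc where "enc = (\<lambda>xs. foldr (\<lambda>x y. pr (x, y)) xs u)"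
  have encU: "enc xs \<in> U" if "xs \<in> lists U" for xs
    using that pr(2) u by (induction xs) (auto simp: enc_def)
  have inj: "xs = ys" if "length xs = length ys" "xs \<in> lists U" "ys \<in> lists U" "enc xs = enc ys"
    for xs ys
    using that
  proof (induction rule: list_induct2)
    case (Cons x xs y ys)
    have "pr (x, enc xs) = pr (y, enc ys)"
      using Cons.prems by (simp add: enc_def)
    then have "x = y \<and> enc xs = enc ys"
      using inj_onD[OF pr(1), of "(x, enc xs)" "(y, enc ys)"] Cons.prems encU by simp
    then show ?case using Cons by simp
  qed simp
  have "lists U \<lesssim> (UNIV :: nat set) \<times> U"
    unfolding lepoll_def
  proof (intro exI conjI)
    show "inj_on (\<lambda>xs. (length xs, enc xs)) (lists U)"
      by (rule inj_onI) (use inj in auto)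
  qed (use encU in auto)
  moreover have "(UNIV :: nat set) \<times> U \<lesssim> U"
    by (rule lepoll_Times_infinite[OF assms countable_lepoll_infinite[OF _ assms] lepoll_refl]) simp
  ultimately show ?thesis using lepoll_trans by blast
qed

text \<open>For infinite \<open>'g\<close> a function is recovered from its graph, and an injection
  of \<open>'g \<times> rat\<close> into \<open>'g\<close> turns the graph into a subset of
  \<open>'g\<close>. For finite \<open>'g\<close> there are only countably many functions, and the
  factor \<open>nat\<close> makes room for them.\<close>

lemma functions_rat_lepoll: "(UNIV :: ('g \<Rightarrow> rat) set) \<lesssim> (UNIV :: ('g set \<times> nat) set)"
proof (cases "finite (UNIV :: 'g set)")
  case True
  have "countable (Pi\<^sub>E (UNIV :: 'g set) (\<lambda>_. UNIV :: rat set))"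
    by (rule countable_PiE[OF True]) simp
  then have "countable (UNIV :: ('g \<Rightarrow> rat) set)"
    by (simp add: PiE_UNIV_domain)
  moreover have "infinite (UNIV :: ('g set \<times> nat) set)"
    by (simp add: finite_prod)
  ultimately show ?thesis by (rule countable_lepoll_infinite)
next
  case False
  have "(UNIV :: 'g set) \<times> (UNIV :: rat set) \<lesssim> (UNIV :: 'g set)"
    by (rule lepoll_Times_infinite[OF False lepoll_refl countable_lepoll_infinite[OF _ False]]) simp
  then obtain e :: "'g \<times> rat \<Rightarrow> 'g" where e: "inj e"
    unfolding lepoll_def by auto
  have "inj (\<lambda>f :: 'g \<Rightarrow> rat. (e ` range (\<lambda>x. (x, f x)), 0 :: nat))"
  proof (rule injI)
    fix f h :: "'g \<Rightarrow> rat"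
    assume "(e ` range (\<lambda>x. (x, f x)), 0 :: nat) = (e ` range (\<lambda>x. (x, h x)), 0)"
    then have "range (\<lambda>x. (x, f x)) = range (\<lambda>x. (x, h x))"
      using e by (simp add: inj_image_eq_iff)
    then have "(x, f x) \<in> range (\<lambda>x. (x, h x))" for x by blast
    then show "f = h" by auto
  qed
  then show ?thesis unfolding lepoll_def by blast
qed

text \<open>The tuples index the generators of the module constructed below, and lists of tuples
  index their finite sums. This bound lets the module live on the type
  \<open>'g set \<times> nat\<close>.\<close>

lemma generator_lists_lepoll:
  "(UNIV :: (rat \<times> nat \<times> 'g \<times> 'g set \<times> ('g \<Rightarrow> rat)) list set)
     \<lesssim> (UNIV :: ('g set \<times> nat) set)"
proof -
  let ?U = "UNIV :: ('g set \<times> nat) set"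
  have inf: "infinite ?U" by (simp add: finite_prod)
  have g: "(UNIV :: 'g set) \<lesssim> ?U"
    unfolding lepoll_def by (rule exI[of _ "\<lambda>x. ({x}, 0)"]) (simp add: inj_def)
  have s: "(UNIV :: 'g set set) \<lesssim> ?U"
    unfolding lepoll_def by (rule exI[of _ "\<lambda>x. (x, 0)"]) (simp add: inj_def)
  have "(UNIV :: rat set) \<times> (UNIV :: nat set) \<times> (UNIV :: 'g set)
      \<times> (UNIV :: 'g set set) \<times> (UNIV :: ('g \<Rightarrow> rat) set) \<lesssim> ?U"
    by (intro lepoll_Times_infinite[OF inf] g s functions_rat_lepoll
        countable_lepoll_infinite[OF _ inf]) auto
  then have "lists (UNIV :: (rat \<times> nat \<times> 'g \<times> 'g set \<times> ('g \<Rightarrow> rat)) set) \<lesssim> lists ?U"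
    by (intro lists_lepoll_mono) simp
  then show ?thesis
    using lists_lepoll_infinite[OF inf] lepoll_trans by auto
qed

section \<open>Localised integers\<close>

lemma Zloc_of_int [simp]:
  assumes "prime p"
  shows "of_int a \<in> Zloc p"
proof -
  have "of_int a = (of_int a / of_int 1 :: rat)" "(1 :: int) \<noteq> 0" "\<not> p dvd 1"
    using assms not_prime_unit by auto
  then show ?thesis unfolding Zloc_def by blast
qed

lemma Zloc_add:
  assumes "prime p" "q \<in> Zloc p" "r \<in> Zloc p"
  shows "q + r \<in> Zloc p"
proof -
  obtain a b c d where "b \<noteq> 0" "\<not> p dvd b" "q = of_int a / of_int b"
    "d \<noteq> 0" "\<not> p dvd d" "r = of_int c / of_int d"
    using assms(2,3) unfolding Zloc_def by blast
  then have "q + r = of_int (a * d + c * b) / of_int (b * d)" "b * d \<noteq> 0" "\<not> p dvd b * d"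
    using assms(1) by (simp_all add: field_simps prime_dvd_mult_iff)
  then show ?thesis unfolding Zloc_def by blast
qed

lemma Zloc_mult:
  assumes "prime p" "q \<in> Zloc p" "r \<in> Zloc p"
  shows "q * r \<in> Zloc p"
proof -
  obtain a b c d where "b \<noteq> 0" "\<not> p dvd b" "q = of_int a / of_int b"
    "d \<noteq> 0" "\<not> p dvd d" "r = of_int c / of_int d"
    using assms(2,3) unfolding Zloc_def by blast
  then have "q * r = of_int (a * c) / of_int (b * d)" "b * d \<noteq> 0" "\<not> p dvd b * d"
    using assms(1) by (simp_all add: field_simps prime_dvd_mult_iff)
  then show ?thesis unfolding Zloc_def by blast
qed

lemma Zloc_inverse_of_int:
  assumes "\<not> p dvd b"
  shows "1 / of_int b \<in> Zloc p"
proof -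
  have "1 / of_int b = (of_int 1 / of_int b :: rat)" "b \<noteq> 0"
    using assms by auto
  then show ?thesis using assms unfolding Zloc_def by blast
qed

lemma Zloc_of_int_div_power:
  assumes "prime p" "of_int a / of_int (p ^ n) \<in> Zloc p"
  shows "p ^ n dvd a"
proof -
  obtain c b where cb: "b \<noteq> 0" "\<not> p dvd b" "of_int a / of_int (p ^ n) = (of_int c / of_int b :: rat)"
    using assms(2) unfolding Zloc_def by blast
  then have "(of_int (a * b) :: rat) = of_int (c * p ^ n)"
    using prime_gt_0_int[OF assms(1)] by (simp add: field_simps)
  then have "a * b = c * p ^ n" by linarith
  then have "p ^ n dvd a * b" by simp
  moreover have "coprime (p ^ n) b"
    using assms(1) cb(2) by (simp add: prime_imp_coprime)
  ultimately show ?thesis by (simp add: coprime_dvd_mult_left_iff)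
qed

text \<open>Cancelling the \<open>p\<close>-part of the denominator shows that Q/Z_(p) is
  \<open>p\<close>-primary torsion.\<close>

lemma ex_power_mult_in_Zloc:
  assumes "prime p"
  shows "\<exists>k. of_int (p ^ k) * q \<in> Zloc p"
proof -
  obtain a b where ab: "q = of_int a / of_int b" "b > 0"
    by (metis Fract_of_int_quotient Rat_cases)
  obtain c where c: "b = p ^ multiplicity p b * c" "\<not> p dvd c"
    using ab(2) assms by (metis multiplicity_decompose' not_prime_unit less_irrefl)
  have "c \<noteq> 0" using c(2) by auto
  have "of_int (p ^ multiplicity p b) * q = of_int a / of_int c"
    using prime_gt_0_int[OF assms] \<open>c \<noteq> 0\<close> by (subst ab(1), subst c(1)) simp
  then show ?thesis using \<open>c \<noteq> 0\<close> c(2) unfolding Zloc_def by blast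
qed

lemma group_Zmod:
  assumes "p > 0"
  shows "group (Zmod p n)"
proof (rule groupI)
  fix x y z assume "x \<in> carrier (Zmod p n)" "y \<in> carrier (Zmod p n)" "z \<in> carrier (Zmod p n)"
  show "x \<otimes>\<^bsub>Zmod p n\<^esub> y \<otimes>\<^bsub>Zmod p n\<^esub> z = x \<otimes>\<^bsub>Zmod p n\<^esub> (y \<otimes>\<^bsub>Zmod p n\<^esub> z)"
    by (simp add: Zmod_def mod_simps add.assoc)
next
  fix x assume "x \<in> carrier (Zmod p n)"
  then show "\<exists>y\<in>carrier (Zmod p n). y \<otimes>\<^bsub>Zmod p n\<^esub> x = \<one>\<^bsub>Zmod p n\<^esub>"
    using assms by (intro bexI[of _ "(- x) mod p ^ n"]) (simp_all add: Zmod_def mod_simps)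
qed (use assms in \<open>simp_all add: Zmod_def\<close>)

lemma inv_Zmod:
  assumes "p > 0" "x \<in> carrier (Zmod p n)"
  shows "inv\<^bsub>Zmod p n\<^esub> x = (- x) mod p ^ n"
proof -
  interpret Zm: group "Zmod p n" by (rule group_Zmod[OF assms(1)])
  show ?thesis
    using assms by (intro Zm.inv_equality) (simp_all add: Zmod_def mod_simps)
qed

lemma additive_sum_list:
  assumes "h 0 = (0 :: 'a :: monoid_add)" "\<And>F F'. h (F + F') = h F + (h F' :: 'a)"
  shows "h (sum_list Fs) = sum_list (map h Fs)"
  by (induction Fs) (simp_all add: assms)

section \<open>The twisted action on rationals modulo the localised integers\<close>

locale oriented =
  fixes p :: int and G :: "('g, 'b) monoid_scheme" (structure) and T :: "'g topology"
    and \<theta> :: "'g \<Rightarrow> nat \<Rightarrow> int"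
  assumes prime_p: "prime p"
    and profinite: "profinite_group G T"
    and orientation: "p_orientation p G T \<theta>"
begin

lemma group_G: "group G"
  using profinite unfolding profinite_group_def topological_group_def by blast

sublocale group G by (rule group_G)

lemma topspace_T: "topspace T = carrier G"
  using profinite unfolding profinite_group_def topological_group_def by blast

section \<open>Translations and neighbourhoods of the identity\<close>

lemma continuous_translation:
  assumes "g \<in> carrier G"
  shows "continuous_map T T (\<lambda>x. g \<otimes> x)" "continuous_map T T (\<lambda>x. x \<otimes> g)"
proof -
  have m: "continuous_map (prod_topology T T) T (\<lambda>(x, y). x \<otimes> y)"
    using profinite unfolding profinite_group_def topological_group_def by blast
  have "continuous_map T (prod_topology T T) (\<lambda>x. (g, x))"
    "continuous_map T (prod_topology T T) (\<lambda>x. (x, g))"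
    using assms by (simp_all add: continuous_map_pairwise o_def topspace_T)
  then show "continuous_map T T (\<lambda>x. g \<otimes> x)" "continuous_map T T (\<lambda>x. x \<otimes> g)"
    by (auto simp: o_def dest!: continuous_map_compose[OF _ m])
qed

text \<open>This is "eventually, as \<open>u\<close> tends to the identity". Continuity and
  discreteness conditions are kept in this form at the identity, and translation carries them to
  other points.\<close>

definition near :: "('g \<Rightarrow> bool) \<Rightarrow> bool" where
  "near P \<longleftrightarrow> (\<exists>U. openin T U \<and> \<one> \<in> U \<and> (\<forall>u\<in>U. P u))"

lemma nearI: "openin T U \<Longrightarrow> \<one> \<in> U \<Longrightarrow> (\<And>u. u \<in> U \<Longrightarrow> P u) \<Longrightarrow> near P"
  unfolding near_def by blast

lemma openin_carrier: "openin T U \<Longrightarrow> U \<subseteq> carrier G"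
  using openin_subset topspace_T by blast

lemma near_mono:
  assumes "near P" "\<And>u. u \<in> carrier G \<Longrightarrow> P u \<Longrightarrow> Q u"
  shows "near Q"
  using assms openin_carrier unfolding near_def by blast

lemma near_conj:
  assumes "near P" "near Q"
  shows "near (\<lambda>u. P u \<and> Q u)"
proof -
  obtain U V where "openin T U" "\<one> \<in> U" "\<forall>u\<in>U. P u" "openin T V" "\<one> \<in> V" "\<forall>u\<in>V. Q u"
    using assms unfolding near_def by blast
  then show ?thesis by (intro nearI[of "U \<inter> V"]) auto
qed

lemma near_True: "(\<And>u. u \<in> carrier G \<Longrightarrow> P u) \<Longrightarrow> near P"
  using openin_topspace[of T] one_closed unfolding near_def topspace_T by blast

lemma near_conjugate:
  assumes "near P" "g \<in> carrier G"
  shows "near (\<lambda>u. P (inv g \<otimes> u \<otimes> g))"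
proof -
  obtain U where U: "openin T U" "\<one> \<in> U" "\<forall>u\<in>U. P u"
    using assms unfolding near_def by blast
  have "continuous_map T T ((\<lambda>x. x \<otimes> g) \<circ> (\<lambda>x. inv g \<otimes> x))"
    using assms by (intro continuous_map_compose[of _ T] continuous_translation) auto
  then have "openin T {x \<in> topspace T. inv g \<otimes> x \<otimes> g \<in> U}"
    using U(1) by (auto intro: openin_continuous_map_preimage simp: o_def)
  then show ?thesis
    by (rule nearI) (use U assms in \<open>auto simp: topspace_T\<close>)
qed

lemma openin_translate:
  assumes "openin T U" "g \<in> carrier G"
  shows "openin T {x \<in> carrier G. inv g \<otimes> x \<in> U}"
  using openin_continuous_map_preimage[OF continuous_translation(1) assms(1), of "inv g"] assms(2)
  by (simp add: topspace_T)

text \<open>Left translation by \<open>a\<close> turns a neighbourhood of the identity into one of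
  \<open>a\<close>. The lemma converts \<open>near\<close> back into the openness that the
  definitions ask for.\<close>

lemma openin_if_near:
  assumes "A \<subseteq> carrier G" "\<And>a. a \<in> A \<Longrightarrow> near (\<lambda>u. a \<otimes> u \<in> A)"
  shows "openin T A"
proof (subst openin_subopen, intro ballI)
  fix a assume a: "a \<in> A"
  obtain U where U: "openin T U" "\<one> \<in> U" "\<forall>u\<in>U. a \<otimes> u \<in> A"
    using assms(2)[OF a] unfolding near_def by blast
  let ?V = "{x \<in> carrier G. inv a \<otimes> x \<in> U}"
  have a': "a \<in> carrier G" using a assms(1) by blast
  have "?V \<subseteq> A"
  proof
    fix x assume x: "x \<in> ?V"
    then have "a \<otimes> (inv a \<otimes> x) \<in> A" using U(3) by blast
    then show "x \<in> A" using x a' by (simp add: m_assoc[symmetric])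
  qed
  then show "\<exists>V. openin T V \<and> a \<in> V \<and> V \<subseteq> A"
    using openin_translate[OF U(1) a'] U(2) a' by auto
qed

text \<open>Compactness enters here: finitely many translates of one neighbourhood of the identity
  cover the group. This stands in for the finite index of open subgroups.\<close>

lemma near_finite_cover:
  assumes "near P"
  shows "\<exists>R. finite R \<and> R \<subseteq> carrier G \<and> (\<forall>g\<in>carrier G. \<exists>x\<in>R. P (inv x \<otimes> g))"
proof -
  obtain U where U: "openin T U" "\<one> \<in> U" "\<forall>u\<in>U. P u"
    using assms unfolding near_def by blast
  define V where "V = (\<lambda>g. {x \<in> carrier G. inv g \<otimes> x \<in> U})"
  have "compact_space T"
    using profinite unfolding profinite_group_def by blast
  moreover have "\<forall>B\<in>V ` carrier G. openin T B"
    using openin_translate[OF U(1)] by (auto simp: V_def)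
  moreover have "topspace T \<subseteq> \<Union> (V ` carrier G)"
    using U(2) by (auto simp: V_def topspace_T)
  ultimately obtain \<F> where F: "finite \<F>" "\<F> \<subseteq> V ` carrier G" "topspace T \<subseteq> \<Union> \<F>"
    unfolding compact_space_alt by meson
  obtain R where "R \<subseteq> carrier G" "finite R" "\<F> = V ` R"
    using finite_subset_image[OF F(1,2)] by blast
  then show ?thesis
    using F(3) U(3) by (intro exI[of _ R]) (fastforce simp: V_def topspace_T)
qed

section \<open>Congruences for the orientation\<close>

lemma p_gt_0 [simp]: "p > 0" and p_ge_0 [simp]: "p \<ge> 0" and p_neq_0 [simp]: "p \<noteq> 0"
    and p_gt_1 [simp]: "p > 1"
  using prime_gt_0_int[OF prime_p] prime_gt_1_int[OF prime_p] by auto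

lemma theta_range: "g \<in> carrier G \<Longrightarrow> 0 \<le> \<theta> g n \<and> \<theta> g n < p ^ n"
  using orientation unfolding p_orientation_def padic_unit_def padic_int_def by blast

lemma theta_mult:
  "g \<in> carrier G \<Longrightarrow> h \<in> carrier G \<Longrightarrow> \<theta> (g \<otimes> h) n = (\<theta> g n * \<theta> h n) mod p ^ n"
  using orientation unfolding p_orientation_def by blast

lemma theta_mod:
  assumes "g \<in> carrier G" "l \<le> k"
  shows "\<theta> g k mod p ^ l = \<theta> g l"
  using assms(2)
proof (induction k rule: dec_induct)
  case base
  then show ?case using theta_range[OF assms(1), of l] by simp
next
  case (step k)
  have "\<theta> g (Suc k) mod p ^ k = \<theta> g k"
    using orientation assms(1) unfolding p_orientation_def padic_unit_def padic_int_def by blast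
  moreover have "p ^ l dvd p ^ k" using step by (simp add: le_imp_power_dvd)
  ultimately show ?case using step.IH by (metis mod_mod_cancel)
qed

lemma theta_not_dvd:
  assumes "g \<in> carrier G" "n \<ge> 1"
  shows "\<not> p dvd \<theta> g n"
proof -
  have "\<theta> g 1 \<noteq> 0"
    using orientation assms(1) unfolding p_orientation_def padic_unit_def by blast
  moreover have "\<theta> g n mod p = \<theta> g 1"
    using theta_mod[OF assms] by simp
  ultimately show ?thesis by (simp add: dvd_eq_mod_eq_0)
qed

text \<open>The residue is idempotent and, for \<open>n > 0\<close>, prime to \<open>p\<close>,
  hence congruent to 1. A congruence is all that holds uniformly, since for \<open>n = 0\<close> the
  residue itself is 0.\<close>

lemma theta_one: "p ^ n dvd \<theta> \<one> n - 1"
proof (cases "n = 0")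
  case False
  have "\<theta> \<one> n = (\<theta> \<one> n * \<theta> \<one> n) mod p ^ n"
    using theta_mult[of \<one> \<one> n] by simp
  then have "p ^ n dvd \<theta> \<one> n * \<theta> \<one> n - \<theta> \<one> n"
    by (metis dvd_minus_mod)
  then have "p ^ n dvd \<theta> \<one> n * (\<theta> \<one> n - 1)"
    by (simp add: algebra_simps)
  moreover have "coprime (p ^ n) (\<theta> \<one> n)"
    using theta_not_dvd[of \<one> n] False prime_p by (simp add: prime_imp_coprime)
  ultimately show ?thesis by (simp add: coprime_dvd_mult_right_iff)
qed simp

lemma near_theta: "near (\<lambda>u. \<theta> u n = \<theta> \<one> n)"
proof (rule nearI)
  show "openin T {g \<in> carrier G. \<theta> g n = \<theta> \<one> n}"
    using orientation unfolding p_orientation_def by blast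
qed auto

section \<open>Congruence modulo Z_(p) and the action of the group\<close>

abbreviation Z where "Z \<equiv> Zloc p"

lemma Z_simps [simp]: "of_int a \<in> Z" "0 \<in> Z" "1 \<in> Z"
  using Zloc_of_int[OF prime_p, of 0] Zloc_of_int[OF prime_p, of 1] by (auto simp: prime_p)

lemma Z_add [simp, intro]: "q \<in> Z \<Longrightarrow> r \<in> Z \<Longrightarrow> q + r \<in> Z"
  by (rule Zloc_add[OF prime_p])

lemma Z_mult [simp, intro]: "q \<in> Z \<Longrightarrow> r \<in> Z \<Longrightarrow> q * r \<in> Z"
  by (rule Zloc_mult[OF prime_p])

lemma Z_uminus [simp, intro]: "q \<in> Z \<Longrightarrow> - q \<in> Z"
  using Z_mult[OF Z_simps(1), of q "- 1"] by simp

lemma Z_diff [simp, intro]: "q \<in> Z \<Longrightarrow> r \<in> Z \<Longrightarrow> q - r \<in> Z"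
  using Z_add[of q "- r"] by simp

lemma Z_p [simp]: "of_int p ^ k \<in> Z"
  using Z_simps(1)[of "p ^ k"] by simp

lemma Z_cong: "q - r \<in> Z \<Longrightarrow> q \<in> Z \<longleftrightarrow> r \<in> Z"
  using Z_add[of "q - r" r] Z_diff[of q "q - r"] by auto

lemma Z_commute: "q - r \<in> Z \<longleftrightarrow> r - q \<in> Z"
  using Z_uminus[of "q - r"] Z_uminus[of "r - q"] by auto

lemma Z_sym: "q - r \<in> Z \<Longrightarrow> r - q \<in> Z"
  using Z_commute by blast

lemma Z_trans: "q - r \<in> Z \<Longrightarrow> r - s \<in> Z \<Longrightarrow> q - s \<in> Z"
  using Z_add[of "q - r" "r - s"] by simp

text \<open>The rational number \<open>twist g q\<close> represents the action of \<open>g\<close> on the class of \<open>q\<close> in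
  \<open>\<rat>/\<int>\<^sub>(\<^sub>p\<^sub>)\<close>; only its class matters.\<close>
definition twist :: "'g \<Rightarrow> rat \<Rightarrow> rat" where
  "twist g q = of_int (\<theta> g (LEAST k. of_int p ^ k * q \<in> Z)) * q"

text \<open>The class does not depend on the exponent: with \<open>l\<close> the least exponent,
  \<open>\<theta> g k\<close> and \<open>\<theta> g l\<close> agree modulo \<open>p ^ l\<close>, and
  \<open>p ^ l\<close> already kills the class of \<open>q\<close>.\<close>

lemma twist_eq:
  assumes "g \<in> carrier G" "of_int p ^ k * q \<in> Z"
  shows "of_int (\<theta> g k) * q - twist g q \<in> Z"
proof -
  define l where "l = (LEAST k. of_int p ^ k * q \<in> Z)"
  have l: "of_int p ^ l * q \<in> Z" "l \<le> k"
    using assms(2) unfolding l_def by (auto intro: LeastI Least_le)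
  have "p ^ l dvd \<theta> g k - \<theta> g l"
    using theta_mod[OF assms(1) l(2)] by (metis dvd_minus_mod)
  then obtain m where m: "\<theta> g k - \<theta> g l = p ^ l * m" by blast
  have "of_int (\<theta> g k) * q - twist g q = of_int (\<theta> g k - \<theta> g l) * q"
    by (simp add: twist_def l_def[symmetric] left_diff_distrib)
  also have "\<dots> = of_int m * (of_int p ^ l * q)"
    unfolding m by simp
  finally show ?thesis using Z_mult[OF Z_simps(1) l(1)] by (simp only:)
qed

lemma ex_level: "\<exists>k. of_int p ^ k * q \<in> Z"
  using ex_power_mult_in_Zloc[OF prime_p, of q] by simp

lemma level_mono:
  assumes "of_int p ^ k * q \<in> Z" "k \<le> l"
  shows "of_int p ^ l * q \<in> Z"
proof -
  have "of_int p ^ l = of_int p ^ (l - k) * (of_int p ^ k :: rat)"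
    using assms(2) by (simp flip: power_add)
  then have "of_int p ^ l * q = of_int p ^ (l - k) * (of_int p ^ k * q)"
    by (simp only: mult.assoc)
  then show ?thesis using Z_mult[OF Z_p assms(1)] by (simp only:)
qed

lemma ex_level2: "\<exists>k. of_int p ^ k * q \<in> Z \<and> of_int p ^ k * r \<in> Z"
proof -
  obtain k l where "of_int p ^ k * q \<in> Z" "of_int p ^ l * r \<in> Z"
    using ex_level by meson
  then show ?thesis
    using level_mono[of k q "max k l"] level_mono[of l r "max k l"] by auto
qed

lemma twist_add:
  assumes "g \<in> carrier G"
  shows "twist g (q + r) - (twist g q + twist g r) \<in> Z"
proof -
  obtain k where k: "of_int p ^ k * q \<in> Z" "of_int p ^ k * r \<in> Z"
    using ex_level2 by blast
  then have "of_int p ^ k * (q + r) \<in> Z" by (simp add: distrib_left)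
  then have "of_int (\<theta> g k) * (q + r) - twist g (q + r) \<in> Z"
    "of_int (\<theta> g k) * q - twist g q \<in> Z" "of_int (\<theta> g k) * r - twist g r \<in> Z"
    using k twist_eq[OF assms] by auto
  then have "(of_int (\<theta> g k) * q - twist g q) + (of_int (\<theta> g k) * r - twist g r)
     - (of_int (\<theta> g k) * (q + r) - twist g (q + r)) \<in> Z"
    by blast
  then show ?thesis by (simp add: algebra_simps)
qed

lemma twist_scale:
  assumes "g \<in> carrier G" "z \<in> Z"
  shows "twist g (z * q) - z * twist g q \<in> Z"
proof -
  obtain k where k: "of_int p ^ k * q \<in> Z"
    using ex_level by blast
  then have "z * (of_int p ^ k * q) \<in> Z" using assms(2) by blast
  then have "of_int p ^ k * (z * q) \<in> Z" by (simp add: mult.left_commute)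
  then have "of_int (\<theta> g k) * (z * q) - twist g (z * q) \<in> Z"
    "z * (of_int (\<theta> g k) * q - twist g q) \<in> Z"
    using k twist_eq[OF assms(1)] assms(2) by auto
  then have "z * (of_int (\<theta> g k) * q - twist g q) - (of_int (\<theta> g k) * (z * q) - twist g (z * q)) \<in> Z"
    by blast
  then show ?thesis by (simp add: algebra_simps)
qed

lemma twist_uminus:
  assumes "g \<in> carrier G"
  shows "twist g (- q) - (- twist g q) \<in> Z"
  using twist_scale[OF assms, of "-1" q] by simp

lemma twist_Z: "g \<in> carrier G \<Longrightarrow> q \<in> Z \<Longrightarrow> twist g q \<in> Z"
  unfolding twist_def by simp

lemma twist_diff:
  assumes "g \<in> carrier G"
  shows "twist g (q - r) - (twist g q - twist g r) \<in> Z"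
  using Z_add[OF twist_add[OF assms, of q "- r"] twist_uminus[OF assms, of r]]
  by (simp add: algebra_simps)

lemma twist_cong:
  assumes "g \<in> carrier G" "q - r \<in> Z"
  shows "twist g q - twist g r \<in> Z"
  using Z_diff[OF twist_Z[OF assms] twist_diff[OF assms(1), of q r]] by simp

text \<open>An exponent \<open>k\<close> that serves for \<open>q\<close> also serves for
  \<open>\<theta> h k * q\<close>, so both sides can be computed at the one level \<open>k\<close>,
  where multiplicativity of the orientation modulo \<open>p ^ k\<close> applies.\<close>

lemma twist_mult:
  assumes "g \<in> carrier G" "h \<in> carrier G"
  shows "twist (g \<otimes> h) q - twist g (twist h q) \<in> Z"
proof -
  obtain k where k: "of_int p ^ k * q \<in> Z"
    using ex_level by blast
  have "of_int (\<theta> h k) * (of_int p ^ k * q) \<in> Z" using k by simp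
  then have k': "of_int p ^ k * (of_int (\<theta> h k) * q) \<in> Z"
    by (simp add: mult.left_commute)
  have "p ^ k dvd \<theta> g k * \<theta> h k - \<theta> (g \<otimes> h) k"
    using theta_mult[OF assms, of k] by (metis dvd_minus_mod)
  then obtain m where m: "\<theta> g k * \<theta> h k - \<theta> (g \<otimes> h) k = p ^ k * m" by blast
  have "(of_int (\<theta> g k) * (of_int (\<theta> h k) * q)) - of_int (\<theta> (g \<otimes> h) k) * q
      = of_int (\<theta> g k * \<theta> h k - \<theta> (g \<otimes> h) k) * q"
    by (simp add: algebra_simps)
  also have "\<dots> = of_int m * (of_int p ^ k * q)"
    unfolding m by simp
  finally have 1: "of_int (\<theta> g k) * (of_int (\<theta> h k) * q) - of_int (\<theta> (g \<otimes> h) k) * q \<in> Z"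
    using Z_mult[OF Z_simps(1) k] by (simp only:)
  have 2: "of_int (\<theta> g k) * (of_int (\<theta> h k) * q) - twist g (of_int (\<theta> h k) * q) \<in> Z"
    by (rule twist_eq[OF assms(1) k'])
  have 3: "twist g (of_int (\<theta> h k) * q) - twist g (twist h q) \<in> Z"
    by (rule twist_cong[OF assms(1) twist_eq[OF assms(2) k]])
  have 4: "of_int (\<theta> (g \<otimes> h) k) * q - twist (g \<otimes> h) q \<in> Z"
    using twist_eq[OF _ k] assms by blast
  show ?thesis
    by (rule Z_trans[OF Z_sym[OF Z_trans[OF 1 4]] Z_trans[OF 2 3]])
qed

lemma twist_one: "twist \<one> q - q \<in> Z"
proof -
  obtain k where k: "of_int p ^ k * q \<in> Z"
    using ex_level by blast
  obtain m where m: "\<theta> \<one> k - 1 = p ^ k * m"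
    using theta_one by blast
  have "of_int (\<theta> \<one> k) * q - q = of_int (\<theta> \<one> k - 1) * q" by (simp add: algebra_simps)
  also have "\<dots> = of_int m * (of_int p ^ k * q)" unfolding m by simp
  finally have "of_int (\<theta> \<one> k) * q - q \<in> Z" using Z_mult[OF Z_simps(1) k] by (simp only:)
  then show ?thesis
    by (rule Z_trans[OF Z_sym[OF twist_eq[OF one_closed k]]])
qed

lemma twist_inv_cancel:
  assumes "g \<in> carrier G"
  shows "twist (inv g) (twist g q) - q \<in> Z"
  using Z_trans[OF Z_sym[OF twist_mult[of "inv g" g q]], of q] twist_one[of q] assms by simp

lemma twist_Z_iff: "g \<in> carrier G \<Longrightarrow> twist g q \<in> Z \<longleftrightarrow> q \<in> Z"
  using twist_Z[of "inv g" "twist g q"] Z_cong[OF twist_inv_cancel[of g q]] twist_Z[of g q] inv_closed[of g]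
  by argo

text \<open>Discreteness of the module Q/Z_(p): the stabiliser of a class killed by
  \<open>p ^ k\<close> contains every \<open>u\<close> whose orientation agrees with that of the
  identity modulo \<open>p ^ k\<close>.\<close>

lemma near_twist: "near (\<lambda>u. twist u q - q \<in> Z)"
proof -
  obtain k where k: "of_int p ^ k * q \<in> Z"
    using ex_level by blast
  have "twist u q - q \<in> Z" if u: "u \<in> carrier G" "\<theta> u k = \<theta> \<one> k" for u
  proof -
    have 1: "of_int (\<theta> u k) * q - twist u q \<in> Z" and 2: "of_int (\<theta> u k) * q - twist \<one> q \<in> Z"
      using twist_eq[OF u(1) k] twist_eq[OF one_closed k] u(2) by simp_all
    show ?thesis
      by (rule Z_trans[OF Z_trans[OF Z_sym[OF 1] 2] twist_one])
  qed
  then show ?thesis by (rule near_mono[OF near_theta[of k]])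
qed

section \<open>Towers of functions on the group\<close>

text \<open>A function \<open>F\<close> stands for a map from \<open>G\<close> to sequences in \<open>S\<close>: the rational \<open>F x i\<close>
  represents the \<open>i\<close>-th entry modulo \<open>\<int>\<^sub>(\<^sub>p\<^sub>)\<close>.  On towers, \<open>shift 1\<close> is division by \<open>p\<close>.  Values outside
  the carrier are irrelevant; \<open>translate\<close> sets them to 0 so that \<open>translate_mult\<close> is an equation.\<close>

definition translate :: "'g \<Rightarrow> ('g \<Rightarrow> nat \<Rightarrow> rat) \<Rightarrow> 'g \<Rightarrow> nat \<Rightarrow> rat" where
  "translate g F = (\<lambda>x i. if x \<in> carrier G then F (x \<otimes> g) i else 0)"

definition scale :: "rat \<Rightarrow> ('g \<Rightarrow> nat \<Rightarrow> rat) \<Rightarrow> 'g \<Rightarrow> nat \<Rightarrow> rat" where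
  "scale z F = (\<lambda>x i. z * F x i)"

definition shift :: "nat \<Rightarrow> ('g \<Rightarrow> nat \<Rightarrow> rat) \<Rightarrow> 'g \<Rightarrow> nat \<Rightarrow> rat" where
  "shift k F = (\<lambda>x i. F x (i + k))"

lemma op_apply [simp]: "x \<in> carrier G \<Longrightarrow> translate g F x i = F (x \<otimes> g) i"
  "scale z F x i = z * F x i" "shift k F x i = F x (i + k)"
  by (simp_all add: translate_def scale_def shift_def)

lemma op_add: "translate g (F + F') = translate g F + translate g F'"
  "scale z (F + F') = scale z F + scale z F'"
  "shift k (F + F') = shift k F + shift k F'"
  by (auto simp: fun_eq_iff distrib_left translate_def)

lemma op_zero: "translate g 0 = 0" "scale z 0 = 0" "shift k 0 = 0"
  by (simp_all add: fun_eq_iff translate_def)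

lemma translate_mult:
  assumes "g \<in> carrier G" "h \<in> carrier G"
  shows "translate (g \<otimes> h) F = translate g (translate h F)"
  using assms by (auto simp: fun_eq_iff translate_def m_assoc)

lemma translate_scale: "translate g (scale z F) = scale z (translate g F)"
  and translate_shift: "translate g (shift k F) = shift k (translate g F)"
  and scale_scale: "scale y (scale z F) = scale (y * z) F" and shift_shift: "shift k (shift l F) = shift (k + l) F"
  and shift_scale: "shift k (scale z F) = scale z (shift k F)"
  by (auto simp: fun_eq_iff translate_def add_ac)

text \<open>With b the sequence \<open>F \<one>\<close>, these functions represent x |-> theta(x) b.
  In the module they give the torsion classes.\<close>

definition twisted :: "('g \<Rightarrow> nat \<Rightarrow> rat) \<Rightarrow> bool" where
  "twisted F \<longleftrightarrow> (\<forall>x\<in>carrier G. \<forall>i. F x i - twist x (F \<one> i) \<in> Z)"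

text \<open>The twisted functions with b_0 = 0, which the module divides out. Only the entry at
  level 0 is constrained, so b itself may be nonzero; this is what turns the divisible torsion-free
  object B into S.\<close>

definition null :: "('g \<Rightarrow> nat \<Rightarrow> rat) \<Rightarrow> bool" where
  "null F \<longleftrightarrow> twisted F \<and> F \<one> 0 \<in> Z"

definition tower :: "('g \<Rightarrow> nat \<Rightarrow> rat) \<Rightarrow> bool" where
  "tower F \<longleftrightarrow> (\<forall>x\<in>carrier G. \<forall>i. of_int p * F x (Suc i) - F x i \<in> Z)"

text \<open>The second condition makes every level locally constant, uniformly in \<open>x\<close>;
  the third says that translations near the identity fix \<open>F\<close> modulo twisted functions.
  Together, with the second at level 0, they make the stabiliser of the class of \<open>F\<close>
  open.\<close>

definition admissible :: "('g \<Rightarrow> nat \<Rightarrow> rat) \<Rightarrow> bool" where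
  "admissible F \<longleftrightarrow> tower F \<and> (\<forall>i. near (\<lambda>n. \<forall>x\<in>carrier G. F (x \<otimes> n) i - F x i \<in> Z))
     \<and> near (\<lambda>h. twisted (translate h F - F))"

lemma twistedD: "twisted F \<Longrightarrow> x \<in> carrier G \<Longrightarrow> F x i - twist x (F \<one> i) \<in> Z"
  unfolding twisted_def by blast

lemma twisted_cong:
  assumes "twisted F" "\<And>x i. x \<in> carrier G \<Longrightarrow> F' x i = F x i"
  shows "twisted F'"
  using assms unfolding twisted_def by simp

lemma twisted_Z: "(\<And>x i. x \<in> carrier G \<Longrightarrow> F x i \<in> Z) \<Longrightarrow> twisted F"
  unfolding twisted_def using twist_Z by blast

lemma twisted_add:
  assumes "twisted F" "twisted F'"
  shows "twisted (F + F')"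
  unfolding twisted_def
proof (intro ballI allI)
  fix x i assume x: "x \<in> carrier G"
  have "(F x i - twist x (F \<one> i)) + (F' x i - twist x (F' \<one> i))
      - (twist x (F \<one> i + F' \<one> i) - (twist x (F \<one> i) + twist x (F' \<one> i))) \<in> Z"
    by (intro Z_add Z_diff twistedD assms x twist_add)
  then show "(F + F') x i - twist x ((F + F') \<one> i) \<in> Z"
    by (simp add: algebra_simps)
qed

lemma twisted_scale:
  assumes "twisted F" "z \<in> Z"
  shows "twisted (scale z F)"
  unfolding twisted_def
proof (intro ballI allI)
  fix x i assume x: "x \<in> carrier G"
  have "z * (F x i - twist x (F \<one> i)) - (twist x (z * F \<one> i) - z * twist x (F \<one> i)) \<in> Z"
    by (intro Z_mult Z_diff twistedD assms x twist_scale)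
  then show "scale z F x i - twist x (scale z F \<one> i) \<in> Z"
    by (simp add: algebra_simps)
qed

lemma twisted_translate:
  assumes "twisted F" "g \<in> carrier G"
  shows "twisted (translate g F)"
  unfolding twisted_def
proof (intro ballI allI)
  fix x i assume x: "x \<in> carrier G"
  have 1: "F (x \<otimes> g) i - twist (x \<otimes> g) (F \<one> i) \<in> Z"
    using twistedD[OF assms(1)] x assms(2) by blast
  have 2: "twist x (F g i) - twist x (twist g (F \<one> i)) \<in> Z"
    by (intro twist_cong twistedD assms x)
  have "F (x \<otimes> g) i - twist x (F g i) \<in> Z"
    by (rule Z_trans[OF Z_trans[OF 1 twist_mult[OF x assms(2)]] Z_sym[OF 2]])
  then show "translate g F x i - twist x (translate g F \<one> i) \<in> Z"
    using assms(2) x by simp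
qed

lemma twisted_shift: "twisted F \<Longrightarrow> twisted (shift k F)"
  unfolding twisted_def by simp

lemma scale_minus: "scale (- 1) F = - F"
  by (simp add: fun_eq_iff)

lemma twisted_diff: "twisted F \<Longrightarrow> twisted F' \<Longrightarrow> twisted (F - F')"
  using twisted_add[of F "- F'"] twisted_scale[of F' "- 1"] by (simp add: scale_minus)

lemma nullI_Z:
  assumes "\<And>x i. x \<in> carrier G \<Longrightarrow> F x i \<in> Z"
  shows "null F"
  using twisted_Z assms unfolding null_def by simp

lemma null_0: "null 0"
  by (rule nullI_Z) simp

lemma null_add: "null F \<Longrightarrow> null F' \<Longrightarrow> null (F + F')"
  unfolding null_def using twisted_add by simp

lemma null_diff: "null F \<Longrightarrow> null F' \<Longrightarrow> null (F - F')"
  unfolding null_def using twisted_diff by simp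

lemma null_uminus: "null F \<Longrightarrow> null (- F)"
  using null_diff[OF null_0] by fastforce

lemma null_translate:
  assumes "null F" "g \<in> carrier G"
  shows "null (translate g F)"
proof -
  have "F g 0 - twist g (F \<one> 0) \<in> Z" "twist g (F \<one> 0) \<in> Z"
    using assms twistedD twist_Z unfolding null_def by blast+
  then have "F g 0 \<in> Z" using Z_add by fastforce
  then show ?thesis using twisted_translate assms unfolding null_def by simp
qed

lemma tower_iterate:
  assumes "tower F" "x \<in> carrier G"
  shows "of_int p ^ k * F x (i + k) - F x i \<in> Z"
proof (induction k)
  case (Suc k)
  have "of_int p ^ k * (of_int p * F x (Suc (i + k)) - F x (i + k)) \<in> Z"
    using assms unfolding tower_def by simp
  then have "of_int p ^ Suc k * F x (i + Suc k) - of_int p ^ k * F x (i + k) \<in> Z"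
    by (simp add: algebra_simps)
  then show ?case using Suc Z_trans by blast
qed simp

text \<open>On towers \<open>shift k\<close> inverts multiplication by \<open>p ^ k\<close>, because
  the entry at level \<open>i\<close> is \<open>p ^ k\<close> times the entry at level
  \<open>i + k\<close>.\<close>

lemma null_scale_shift:
  assumes "tower F"
  shows "null (scale (of_int p ^ k) (shift k F) - F)"
  by (rule nullI_Z) (use tower_iterate[OF assms] in simp)

text \<open>Modulo twisted functions, towers have no \<open>p\<close>-torsion: if
  \<open>p ^ k\<close> times \<open>F\<close> is twisted, then so is its shift by \<open>k\<close>,
  which differs from \<open>F\<close> by a null function.\<close>

lemma twisted_if_scale_p_power:
  assumes "tower F" "twisted (scale (of_int p ^ k) F)"
  shows "twisted F"
proof -
  have "twisted (scale (of_int p ^ k) (shift k F))"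
    using twisted_shift[OF assms(2), of k] by (simp add: twisted_def)
  then have "twisted (scale (of_int p ^ k) (shift k F) - (scale (of_int p ^ k) (shift k F) - F))"
    using null_scale_shift[OF assms(1), of k] twisted_diff unfolding null_def by blast
  then show ?thesis by simp
qed

lemma inverse_in_Z: "\<not> p dvd int m \<Longrightarrow> 1 / of_nat m \<in> Z"
  using Zloc_inverse_of_int[of p "int m"] by simp

lemma nat_decompose:
  assumes "n > 0"
  obtains k m where "n = nat p ^ k * m" "m > 0" "\<not> p dvd int m"
proof -
  have "prime (nat p)" using prime_int_nat_transfer[THEN iffD1, OF prime_p] by blast
  then obtain m where m: "n = nat p ^ multiplicity (nat p) n * m" "\<not> nat p dvd m"
    using assms multiplicity_decompose'[of n "nat p"] not_prime_unit by blast
  have "\<not> int (nat p) dvd int m" using m(2) int_dvd_int_iff[of "nat p" m] by blast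
  then have "\<not> p dvd int m" by simp
  moreover have "m > 0" using assms m(1) by (cases m) auto
  ultimately show ?thesis using m(1) that by blast
qed

text \<open>The factor of \<open>n\<close> prime to \<open>p\<close> is invertible in Z_(p), which
  leaves a power of \<open>p\<close>. This undoes the multiplication by \<open>n\<close> that
  averaging over \<open>n\<close> values introduces.\<close>

lemma twisted_if_scale:
  assumes "tower F" "twisted (scale (of_nat n) F)" "n > 0"
  shows "twisted F"
proof -
  obtain k m where km: "n = nat p ^ k * m" "m > 0" "\<not> p dvd int m"
    using nat_decompose[OF assms(3)] .
  have "of_nat (nat p) = (of_int p :: rat)" by simp
  then have "scale (of_int p ^ k) F = scale (1 / of_nat m) (scale (of_nat n) F)"
    using km(2) unfolding km(1) by (simp add: fun_eq_iff)
  then have "twisted (scale (of_int p ^ k) F)"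
    using twisted_scale[OF assms(2) inverse_in_Z[OF km(3)]] by simp
  then show ?thesis by (rule twisted_if_scale_p_power[OF assms(1)])
qed

lemma admissible_tower: "admissible F \<Longrightarrow> tower F"
  unfolding admissible_def by blast

lemma admissible_near: "admissible F \<Longrightarrow> near (\<lambda>n. \<forall>x\<in>carrier G. F (x \<otimes> n) i - F x i \<in> Z)"
  unfolding admissible_def by blast

lemma admissible_near_twisted: "admissible F \<Longrightarrow> near (\<lambda>h. twisted (translate h F - F))"
  unfolding admissible_def by blast

lemma admissible_0: "admissible 0"
  unfolding admissible_def tower_def using near_True twisted_Z by simp

lemma admissible_add:
  assumes "admissible F" "admissible F'"
  shows "admissible (F + F')"
  unfolding admissible_def
proof (intro conjI allI)
  show "tower (F + F')"
    unfolding tower_def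
  proof (intro ballI allI)
    fix x i assume x: "x \<in> carrier G"
    have "(of_int p * F x (Suc i) - F x i) + (of_int p * F' x (Suc i) - F' x i) \<in> Z"
      using x admissible_tower[OF assms(1)] admissible_tower[OF assms(2)] unfolding tower_def by blast
    then show "of_int p * (F + F') x (Suc i) - (F + F') x i \<in> Z"
      by (simp add: algebra_simps)
  qed
  fix i
  show "near (\<lambda>n. \<forall>x\<in>carrier G. (F + F') (x \<otimes> n) i - (F + F') x i \<in> Z)"
  proof (rule near_mono[OF near_conj[OF admissible_near[OF assms(1), of i] admissible_near[OF assms(2), of i]]],
      intro ballI)
    fix n x
    assume *: "(\<forall>x\<in>carrier G. F (x \<otimes> n) i - F x i \<in> Z) \<and> (\<forall>x\<in>carrier G. F' (x \<otimes> n) i - F' x i \<in> Z)"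
      and x: "x \<in> carrier G"
    have "(F (x \<otimes> n) i - F x i) + (F' (x \<otimes> n) i - F' x i) \<in> Z" using * x by blast
    then show "(F + F') (x \<otimes> n) i - (F + F') x i \<in> Z" by (simp add: algebra_simps)
  qed
next
  show "near (\<lambda>h. twisted (translate h (F + F') - (F + F')))"
  proof (rule near_mono[OF near_conj[OF admissible_near_twisted[OF assms(1)] admissible_near_twisted[OF assms(2)]]])
    fix h assume "twisted (translate h F - F) \<and> twisted (translate h F' - F')"
    then have "twisted ((translate h F - F) + (translate h F' - F'))" using twisted_add by blast
    then show "twisted (translate h (F + F') - (F + F'))"
      by (simp add: op_add algebra_simps)
  qed
qed

lemma admissible_scale:
  assumes "admissible F" "z \<in> Z"
  shows "admissible (scale z F)"
  unfolding admissible_def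
proof (intro conjI allI)
  show "tower (scale z F)"
    unfolding tower_def
  proof (intro ballI allI)
    fix x i assume x: "x \<in> carrier G"
    have "z * (of_int p * F x (Suc i) - F x i) \<in> Z"
      using x admissible_tower[OF assms(1)] assms(2) unfolding tower_def by blast
    then show "of_int p * scale z F x (Suc i) - scale z F x i \<in> Z"
      by (simp add: algebra_simps)
  qed
  fix i
  show "near (\<lambda>n. \<forall>x\<in>carrier G. scale z F (x \<otimes> n) i - scale z F x i \<in> Z)"
  proof (rule near_mono[OF admissible_near[OF assms(1), of i]], intro ballI)
    fix n x
    assume *: "\<forall>x\<in>carrier G. F (x \<otimes> n) i - F x i \<in> Z" and x: "x \<in> carrier G"
    have "z * (F (x \<otimes> n) i - F x i) \<in> Z" using * x assms(2) by blast
    then show "scale z F (x \<otimes> n) i - scale z F x i \<in> Z" by (simp add: algebra_simps)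
  qed
next
  show "near (\<lambda>h. twisted (translate h (scale z F) - scale z F))"
  proof (rule near_mono[OF admissible_near_twisted[OF assms(1)]])
    fix h assume "twisted (translate h F - F)"
    then have "twisted (scale z (translate h F - F))" using twisted_scale assms(2) by blast
    then show "twisted (translate h (scale z F) - scale z F)"
      by (rule twisted_cong) (simp add: algebra_simps)
  qed
qed

lemma admissible_shift:
  assumes "admissible F"
  shows "admissible (shift k F)"
  unfolding admissible_def
proof (intro conjI allI)
  show "tower (shift k F)"
    using admissible_tower[OF assms] by (simp add: tower_def)
  show "near (\<lambda>n. \<forall>x\<in>carrier G. shift k F (x \<otimes> n) i - shift k F x i \<in> Z)" for i
    using admissible_near[OF assms, of "i + k"] by simp
  show "near (\<lambda>h. twisted (translate h (shift k F) - shift k F))"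
  proof (rule near_mono[OF admissible_near_twisted[OF assms]])
    fix h assume "twisted (translate h F - F)"
    then have "twisted (shift k (translate h F - F))" using twisted_shift by blast
    then show "twisted (translate h (shift k F) - shift k F)"
      by (rule twisted_cong) simp
  qed
qed

lemma admissible_translate:
  assumes "admissible F" "g \<in> carrier G"
  shows "admissible (translate g F)"
  unfolding admissible_def
proof (intro conjI allI)
  \<comment> \<open>Translating by \<open>h\<close> before \<open>g\<close> amounts to translating
    by the conjugate of \<open>h\<close> after \<open>g\<close>, so the neighbourhoods attached to
    \<open>F\<close> have to be conjugated by \<open>g\<close>.\<close>
  have conj: "x \<otimes> g \<otimes> (inv g \<otimes> h \<otimes> g) = x \<otimes> h \<otimes> g" if "x \<in> carrier G" "h \<in> carrier G" for x h
    using that assms(2) by (metis inv_closed m_assoc m_closed r_inv r_one)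
  show "tower (translate g F)"
    using admissible_tower[OF assms(1)] assms(2) by (simp add: tower_def)
  show "near (\<lambda>n. \<forall>x\<in>carrier G. translate g F (x \<otimes> n) i - translate g F x i \<in> Z)" for i
  proof (rule near_mono[OF near_conjugate[OF admissible_near[OF assms(1), of i] assms(2)]], intro ballI)
    fix n x
    assume *: "\<forall>x\<in>carrier G. F (x \<otimes> (inv g \<otimes> n \<otimes> g)) i - F x i \<in> Z"
      and x: "x \<in> carrier G" "n \<in> carrier G"
    have "F (x \<otimes> g \<otimes> (inv g \<otimes> n \<otimes> g)) i - F (x \<otimes> g) i \<in> Z"
      using * x assms(2) by blast
    then show "translate g F (x \<otimes> n) i - translate g F x i \<in> Z" using x by (simp add: conj)
  qed
  show "near (\<lambda>h. twisted (translate h (translate g F) - translate g F))"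
  proof (rule near_mono[OF near_conjugate[OF admissible_near_twisted[OF assms(1)] assms(2)]])
    fix h assume "twisted (translate (inv g \<otimes> h \<otimes> g) F - F)" and h: "h \<in> carrier G"
    then have "twisted (translate g (translate (inv g \<otimes> h \<otimes> g) F - F))"
      using twisted_translate assms(2) by blast
    then show "twisted (translate h (translate g F) - translate g F)"
      by (rule twisted_cong) (use h assms(2) in \<open>simp add: conj\<close>)
  qed
qed

text \<open>The sequence of the \<open>q / p ^ i\<close> is an element of B with zeroth entry
  \<open>q\<close>. Hence these functions reach every class of Q/Z_(p).\<close>

definition base :: "rat \<Rightarrow> 'g \<Rightarrow> nat \<Rightarrow> rat" where
  "base q = (\<lambda>x i. twist x (q / of_int p ^ i))"

lemma twisted_base: "twisted (base q)"
  unfolding twisted_def base_def using twist_cong[OF _ Z_sym[OF twist_one]] by blast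

lemma base_one: "base q \<one> 0 - q \<in> Z"
  unfolding base_def using twist_one by simp

lemma admissible_base: "admissible (base q)"
  unfolding admissible_def
proof (intro conjI allI)
  show "tower (base q)"
    unfolding tower_def
  proof (intro ballI allI)
    fix x i assume x: "x \<in> carrier G"
    have "twist x (of_int p * (q / of_int p ^ Suc i)) - of_int p * twist x (q / of_int p ^ Suc i) \<in> Z"
      by (rule twist_scale[OF x]) simp
    then show "of_int p * base q x (Suc i) - base q x i \<in> Z"
      using Z_commute by (simp add: base_def)
  qed
  show "near (\<lambda>n. \<forall>x\<in>carrier G. base q (x \<otimes> n) i - base q x i \<in> Z)" for i
  proof (rule near_mono[OF near_twist[of "q / of_int p ^ i"]], intro ballI)
    fix n x
    assume n: "n \<in> carrier G" "twist n (q / of_int p ^ i) - q / of_int p ^ i \<in> Z"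
      and x: "x \<in> carrier G"
    show "base q (x \<otimes> n) i - base q x i \<in> Z"
      unfolding base_def by (rule Z_trans[OF twist_mult[OF x n(1)] twist_cong[OF x n(2)]])
  qed
  show "near (\<lambda>h. twisted (translate h (base q) - base q))"
    by (rule near_True) (intro twisted_diff twisted_translate twisted_base)
qed

section \<open>Cocycles with values in Q/Z_(p) and coinduced functions\<close>

text \<open>Rational representatives of a continuous cocycle. Integrality near the identity is
  enough for continuity, as \<open>S_cocycle_openin\<close> shows.\<close>

definition S_cocycle :: "'g set \<Rightarrow> ('g \<Rightarrow> rat) \<Rightarrow> bool" where
  "S_cocycle H c \<longleftrightarrow> (\<forall>h\<in>H. \<forall>k\<in>H. c (h \<otimes> k) - (c h + twist h (c k)) \<in> Z) \<and> near (\<lambda>h. h \<in> H \<and> c h \<in> Z)"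

definition rep :: "'g set \<Rightarrow> 'g \<Rightarrow> 'g" where
  "rep H x = (SOME y. y \<in> carrier G \<and> inv y \<otimes> x \<in> H)"

lemma rep_props:
  assumes "subgroup H G" "x \<in> carrier G"
  shows "rep H x \<in> carrier G" "inv (rep H x) \<otimes> x \<in> H"
proof -
  have "x \<in> carrier G \<and> inv x \<otimes> x \<in> H"
    using assms subgroup.one_closed by simp
  then have "rep H x \<in> carrier G \<and> inv (rep H x) \<otimes> x \<in> H"
    unfolding rep_def by (rule someI)
  then show "rep H x \<in> carrier G" "inv (rep H x) \<otimes> x \<in> H" by auto
qed

text \<open>The predicate from which \<open>rep\<close> chooses depends only on the left coset of
  \<open>x\<close>, so the choice is constant on cosets.\<close>

lemma rep_mult:
  assumes "subgroup H G" "x \<in> carrier G" "h \<in> H"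
  shows "rep H (x \<otimes> h) = rep H x"
proof -
  have h: "h \<in> carrier G" by (rule subgroup.mem_carrier[OF assms(1,3)])
  have "(y \<in> carrier G \<and> inv y \<otimes> (x \<otimes> h) \<in> H) = (y \<in> carrier G \<and> inv y \<otimes> x \<in> H)" for y
  proof (cases "y \<in> carrier G")
    case True
    have "inv y \<otimes> x \<in> H" if "inv y \<otimes> (x \<otimes> h) \<in> H"
    proof -
      have "inv y \<otimes> (x \<otimes> h) \<otimes> inv h \<in> H"
        by (rule subgroup.m_closed[OF assms(1) that subgroup.m_inv_closed[OF assms(1,3)]])
      then show ?thesis using True h assms(2) by (simp add: m_assoc)
    qed
    moreover have "inv y \<otimes> (x \<otimes> h) \<in> H" if "inv y \<otimes> x \<in> H"
    proof -
      have "inv y \<otimes> x \<otimes> h \<in> H"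
        by (rule subgroup.m_closed[OF assms(1) that assms(3)])
      then show ?thesis using True h assms(2) by (simp add: m_assoc)
    qed
    ultimately show ?thesis by blast
  qed simp
  then show ?thesis unfolding rep_def by simp
qed

lemma induced_admissible:
  fixes cs :: "nat \<Rightarrow> 'g \<Rightarrow> rat"
  assumes H: "open_subgroup G T H" and cs: "\<And>i. S_cocycle H (cs i)"
    and tow: "\<And>i h. h \<in> H \<Longrightarrow> of_int p * cs (Suc i) h - cs i h \<in> Z"
  shows "\<exists>F. admissible F \<and> (\<forall>h\<in>H. twisted (translate h F - F) \<and> (F h 0 - F \<one> 0) - cs 0 h \<in> Z)"
proof -
  have sub: "subgroup H G" using H unfolding open_subgroup_def by blast
  have Hc: "h \<in> carrier G" if "h \<in> H" for h by (rule subgroup.mem_carrier[OF sub that])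
  define F where "F = (\<lambda>x i. twist (rep H x) (cs i (inv (rep H x) \<otimes> x)))"
  \<comment> \<open>The key relation: writing \<open>x = r y\<close> with \<open>y\<close> in
    \<open>H\<close>, the cocycle rule gives F(x h) = r c(y h) = r c(y) + r y c(h) = F(x) + x c(h).
    So translation by \<open>h\<close> changes \<open>F\<close> by the twisted function whose value
    at the identity is c(h).\<close>
  have step: "F (x \<otimes> h) i - F x i - twist x (cs i h) \<in> Z"
    if x: "x \<in> carrier G" and h: "h \<in> H" for x h i
  proof -
    define r y where "r = rep H x" and "y = inv r \<otimes> x"
    have r: "r \<in> carrier G" and y: "y \<in> H"
      using rep_props[OF sub x] by (auto simp: r_def y_def)
    have ry: "r \<otimes> y = x" using r x by (simp add: y_def m_assoc[symmetric])
    have Fx: "F x i = twist r (cs i y)" by (simp add: F_def r_def y_def)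
    have Fxh: "F (x \<otimes> h) i = twist r (cs i (y \<otimes> h))"
      using r x Hc[OF h] by (simp add: F_def rep_mult[OF sub x h] r_def y_def m_assoc)
    have 1: "twist r (cs i (y \<otimes> h)) - twist r (cs i y + twist y (cs i h)) \<in> Z"
      using cs[of i] y h by (intro twist_cong[OF r]) (auto simp: S_cocycle_def)
    have 2: "twist r (cs i y + twist y (cs i h)) - (twist r (cs i y) + twist r (twist y (cs i h))) \<in> Z"
      by (rule twist_add[OF r])
    have 3: "twist x (cs i h) - twist r (twist y (cs i h)) \<in> Z"
      using twist_mult[OF r Hc[OF y]] ry by simp
    have "(twist r (cs i (y \<otimes> h)) - twist r (cs i y + twist y (cs i h)))
      + (twist r (cs i y + twist y (cs i h)) - (twist r (cs i y) + twist r (twist y (cs i h))))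
      - (twist x (cs i h) - twist r (twist y (cs i h))) \<in> Z"
      using 1 2 3 by blast
    then show ?thesis unfolding Fx Fxh by (simp add: algebra_simps)
  qed
  have one: "F h i - F \<one> i - cs i h \<in> Z" if "h \<in> H" for h i
    using Z_trans[OF _ twist_one[of "cs i h"], of "F h i - F \<one> i"] step[OF one_closed that, of i]
      Hc[OF that] by simp
  have tws: "twisted (translate h F - F)" if h: "h \<in> H" for h
    unfolding twisted_def
  proof (intro ballI allI)
    fix x i assume x: "x \<in> carrier G"
    have "F (x \<otimes> h) i - F x i - twist x (F h i - F \<one> i) \<in> Z"
      by (rule Z_trans[OF step[OF x h] Z_sym[OF twist_cong[OF x one[OF h]]]])
    then show "(translate h F - F) x i - twist x ((translate h F - F) \<one> i) \<in> Z"
      using Hc[OF h] x by simp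
  qed
  have "admissible F"
    unfolding admissible_def
  proof (intro conjI allI)
    show "tower F"
      unfolding tower_def
    proof (intro ballI allI)
      fix x i assume x: "x \<in> carrier G"
      define r y where "r = rep H x" and "y = inv r \<otimes> x"
      have r: "r \<in> carrier G" and y: "y \<in> H"
        using rep_props[OF sub x] by (auto simp: r_def y_def)
      have "of_int p \<in> Z" by simp
      then have "(twist r (of_int p * cs (Suc i) y) - twist r (cs i y))
          - (twist r (of_int p * cs (Suc i) y) - of_int p * twist r (cs (Suc i) y)) \<in> Z"
        using twist_cong[OF r tow[OF y]] twist_scale[OF r] by blast
      then show "of_int p * F x (Suc i) - F x i \<in> Z"
        by (simp add: F_def r_def y_def)
    qed
    show "near (\<lambda>n. \<forall>x\<in>carrier G. F (x \<otimes> n) i - F x i \<in> Z)" for i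
    proof (rule near_mono[where P = "\<lambda>h. h \<in> H \<and> cs i h \<in> Z"])
      show "near (\<lambda>h. h \<in> H \<and> cs i h \<in> Z)"
        using cs[of i] unfolding S_cocycle_def by blast
    next
      fix n assume n: "n \<in> H \<and> cs i n \<in> Z"
      have "(F (x \<otimes> n) i - F x i - twist x (cs i n)) + twist x (cs i n) \<in> Z" if "x \<in> carrier G" for x
        using n that step twist_Z by blast
      then show "\<forall>x\<in>carrier G. F (x \<otimes> n) i - F x i \<in> Z" by simp
    qed
    show "near (\<lambda>h. twisted (translate h F - F))"
    proof (rule nearI[of H])
      show "openin T H" "\<one> \<in> H"
        using H subgroup.one_closed[OF sub] unfolding open_subgroup_def by auto
    qed (rule tws)
  qed
  then show ?thesis using tws one by blast
qed

section \<open>Divisibility of cocycles\<close>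

text \<open>A fraction \<open>x / y\<close> has residue \<open>u * x\<close> modulo
  \<open>p ^ n\<close>, where Bezout supplies an inverse \<open>u\<close> of
  \<open>y\<close>.\<close>

lemma Z_residue:
  assumes "q \<in> Z"
  shows "\<exists>a. 0 \<le> a \<and> a < p ^ n \<and> (q - of_int a) / of_int p ^ n \<in> Z"
proof -
  obtain x y where xy: "y \<noteq> 0" "\<not> p dvd y" "q = of_int x / of_int y"
    using assms unfolding Zloc_def by blast
  have "coprime y (p ^ n)"
    using prime_imp_coprime[OF prime_p xy(2)] by (simp add: coprime_commute)
  then obtain u v where uv: "u * y + v * p ^ n = 1"
    using bezout_int[of y "p ^ n"] by auto
  define a where "a = (u * x) mod p ^ n"
  have "u * x - a = p ^ n * (u * x div p ^ n)"
    by (simp add: a_def minus_mod_eq_mult_div)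
  moreover have "x - a * y = (u * x - a) * y + p ^ n * (v * x)"
    using arg_cong[OF uv, of "\<lambda>t. t * x"] by (simp add: algebra_simps)
  ultimately have "x - a * y = p ^ n * (u * x div p ^ n) * y + p ^ n * (v * x)"
    by (simp only:)
  then have "x - a * y = p ^ n * (v * x + (u * x div p ^ n) * y)"
    by (simp only: distrib_left mult.assoc add.commute)
  moreover have "q - of_int a = of_int (x - a * y) / of_int y"
    using xy(1) by (simp add: xy(3) field_simps)
  ultimately have "q - of_int a = of_int (p ^ n * (v * x + (u * x div p ^ n) * y)) / of_int y"
    by (simp only:)
  then have "(q - of_int a) / of_int p ^ n = of_int (v * x + (u * x div p ^ n) * y) * (1 / of_int y)"
    by simp
  then have "(q - of_int a) / of_int p ^ n \<in> Z"
    using Z_mult[OF Z_simps(1) Zloc_inverse_of_int[OF xy(2)]] by (simp only:)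
  moreover have "0 \<le> a" "a < p ^ n" by (simp_all add: a_def)
  ultimately show ?thesis by blast
qed

text \<open>With \<open>residue_unique\<close> this identifies the \<open>p ^ n\<close>-torsion of
  Q/Z_(p) with the residues in \<open>{0..<p ^ n}\<close> via a |-> a / p^n. By
  \<open>twist_residue\<close> the identification respects the action on Z/p^n(1).\<close>

lemma level_residue:
  assumes "of_int p ^ n * q \<in> Z"
  shows "\<exists>a. 0 \<le> a \<and> a < p ^ n \<and> q - of_int a / of_int p ^ n \<in> Z"
proof -
  obtain a where a: "0 \<le> a" "a < p ^ n" "(of_int p ^ n * q - of_int a) / of_int p ^ n \<in> Z"
    using Z_residue[OF assms, of n] by blast
  have "(of_int p ^ n * q - of_int a) / of_int p ^ n = q - of_int a / of_int p ^ n"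
    by (simp add: diff_divide_distrib)
  then show ?thesis using a by metis
qed

lemma Z_of_int_div: "of_int a / of_int p ^ n \<in> Z \<longleftrightarrow> p ^ n dvd a"
proof
  assume "of_int a / of_int p ^ n \<in> Z"
  then show "p ^ n dvd a" using Zloc_of_int_div_power[OF prime_p, of a n] by simp
next
  assume "p ^ n dvd a"
  then obtain m where "a = p ^ n * m" by blast
  then have "of_int a / of_int p ^ n = (of_int m :: rat)" by simp
  then show "of_int a / of_int p ^ n \<in> Z" by simp
qed

lemma residue_unique:
  assumes "0 \<le> a" "a < p ^ n" "0 \<le> b" "b < p ^ n"
    "q - of_int a / of_int p ^ n \<in> Z" "q - of_int b / of_int p ^ n \<in> Z"
  shows "a = b"
proof -
  have "of_int (a - b) / of_int p ^ n \<in> Z"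
    using Z_trans[OF Z_sym[OF assms(5)] assms(6)] by (simp add: diff_divide_distrib)
  then have "a mod p ^ n = b mod p ^ n"
    unfolding Z_of_int_div by (simp add: mod_eq_dvd_iff)
  then show ?thesis using assms(1-4) by simp
qed

lemma twist_residue:
  assumes "g \<in> carrier G"
  shows "of_int (\<theta> g n) * (of_int a / of_int p ^ n) - twist g (of_int a / of_int p ^ n) \<in> Z"
  by (rule twist_eq[OF assms]) simp

section \<open>Calculus of cocycles in Q/Z_(p)\<close>

lemma cocycD:
  "S_cocycle H c \<Longrightarrow> h \<in> H \<Longrightarrow> k \<in> H \<Longrightarrow> c (h \<otimes> k) - (c h + twist h (c k)) \<in> Z"
  unfolding S_cocycle_def by blast

lemma S_cocycle_near: "S_cocycle H c \<Longrightarrow> near (\<lambda>h. h \<in> H \<and> c h \<in> Z)"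
  unfolding S_cocycle_def by blast

lemma open_subgroupD:
  assumes "open_subgroup G T H"
  shows "subgroup H G" "openin T H" "\<one> \<in> H" "h \<in> H \<Longrightarrow> h \<in> carrier G"
  using assms subgroup.one_closed subgroup.mem_carrier unfolding open_subgroup_def by auto

lemma twisted_hom_one:
  assumes "c \<one> - (c \<one> + twist \<one> (c \<one>)) \<in> Z"
  shows "c \<one> \<in> Z"
proof -
  have "twist \<one> (c \<one>) \<in> Z" using Z_uminus[OF assms] by simp
  then show ?thesis using twist_Z_iff[OF one_closed] by blast
qed

lemma S_cocycle_zero:
  assumes "open_subgroup G T H" "\<And>h. h \<in> H \<Longrightarrow> c h \<in> Z"
  shows "S_cocycle H c"
  unfolding S_cocycle_def
proof (intro conjI ballI)
  fix h k assume hk: "h \<in> H" "k \<in> H"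
  have "h \<otimes> k \<in> H" using subgroup.m_closed[OF open_subgroupD(1)[OF assms(1)]] hk by blast
  then show "c (h \<otimes> k) - (c h + twist h (c k)) \<in> Z"
    using hk assms(2) twist_Z open_subgroupD(4)[OF assms(1)] by simp
next
  show "near (\<lambda>h. h \<in> H \<and> c h \<in> Z)"
    using open_subgroupD(2,3)[OF assms(1)] assms(2) by (intro nearI[of H]) auto
qed

lemma S_cocycle_add:
  assumes "open_subgroup G T H" "S_cocycle H c" "S_cocycle H d"
  shows "S_cocycle H (\<lambda>h. c h + d h)"
  unfolding S_cocycle_def
proof (intro conjI ballI)
  fix h k assume hk: "h \<in> H" "k \<in> H"
  have "(c (h \<otimes> k) - (c h + twist h (c k))) + (d (h \<otimes> k) - (d h + twist h (d k)))
     - (twist h (c k + d k) - (twist h (c k) + twist h (d k))) \<in> Z"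
    by (intro Z_add Z_diff cocycD[OF assms(2)] cocycD[OF assms(3)] hk twist_add
        open_subgroupD(4)[OF assms(1)])
  then show "c (h \<otimes> k) + d (h \<otimes> k) - (c h + d h + twist h (c k + d k)) \<in> Z"
    by (simp add: algebra_simps)
next
  show "near (\<lambda>h. h \<in> H \<and> c h + d h \<in> Z)"
    by (rule near_mono[OF near_conj[OF S_cocycle_near[OF assms(2)] S_cocycle_near[OF assms(3)]]]) auto
qed

lemma S_cocycle_scale:
  assumes "open_subgroup G T H" "S_cocycle H c" "z \<in> Z"
  shows "S_cocycle H (\<lambda>h. z * c h)"
  unfolding S_cocycle_def
proof (intro conjI ballI)
  fix h k assume hk: "h \<in> H" "k \<in> H"
  have "z * (c (h \<otimes> k) - (c h + twist h (c k))) - (twist h (z * c k) - z * twist h (c k)) \<in> Z"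
    by (intro Z_mult Z_diff cocycD[OF assms(2)] hk twist_scale assms(3) open_subgroupD(4)[OF assms(1)])
  then show "z * c (h \<otimes> k) - (z * c h + twist h (z * c k)) \<in> Z"
    by (simp add: algebra_simps)
next
  show "near (\<lambda>h. h \<in> H \<and> z * c h \<in> Z)"
    by (rule near_mono[OF S_cocycle_near[OF assms(2)]]) (use assms(3) in auto)
qed

lemma S_cocycle_coboundary:
  assumes "open_subgroup G T H"
  shows "S_cocycle H (\<lambda>h. twist h s - s)"
  unfolding S_cocycle_def
proof (intro conjI ballI)
  fix h k assume "h \<in> H" "k \<in> H"
  then have hk: "h \<in> carrier G" "k \<in> carrier G" using open_subgroupD(4)[OF assms] by auto
  have "(twist (h \<otimes> k) s - twist h (twist k s)) - (twist h (twist k s - s) - (twist h (twist k s) - twist h s)) \<in> Z"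
    by (intro Z_diff twist_mult twist_diff hk)
  then show "twist (h \<otimes> k) s - s - (twist h s - s + twist h (twist k s - s)) \<in> Z"
    by (simp add: algebra_simps)
next
  have "near (\<lambda>h. h \<in> H)"
    using open_subgroupD(2,3)[OF assms] by (intro nearI[of H]) auto
  then show "near (\<lambda>h. h \<in> H \<and> twist h s - s \<in> Z)"
    by (rule near_conj[OF _ near_twist])
qed

text \<open>By compactness a cocycle takes finitely many values modulo Z_(p): on a translate of a
  neighbourhood where it vanishes, it is congruent to its value at the translating point. One power
  of \<open>p\<close> kills them all.\<close>

lemma S_cocycle_level:
  assumes H: "open_subgroup G T H" and c: "S_cocycle H c"
  shows "\<exists>n. \<forall>h\<in>H. of_int p ^ n * c h \<in> Z"
proof -
  obtain R where R: "finite R" "R \<subseteq> carrier G"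
    "\<forall>g\<in>carrier G. \<exists>x\<in>R. inv x \<otimes> g \<in> H \<and> c (inv x \<otimes> g) \<in> Z"
    using near_finite_cover[OF S_cocycle_near[OF c]] by blast
  have "\<exists>n. \<forall>x\<in>R. of_int p ^ n * c x \<in> Z"
    using R(1)
  proof (induction R rule: finite_induct)
    case (insert x R)
    then obtain n m where nm: "\<forall>x\<in>R. of_int p ^ n * c x \<in> Z" "of_int p ^ m * c x \<in> Z"
      using ex_level by meson
    then have "\<forall>y\<in>insert x R. of_int p ^ max n m * c y \<in> Z"
      using level_mono[of n _ "max n m"] level_mono[of m _ "max n m"] by auto
    then show ?case by blast
  qed simp
  then obtain n where n: "\<forall>x\<in>R. of_int p ^ n * c x \<in> Z" by blast
  have "of_int p ^ n * c h \<in> Z" if h: "h \<in> H" for h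
  proof -
    have hG: "h \<in> carrier G" using open_subgroupD(4)[OF H h] .
    obtain x where x: "x \<in> R" "inv x \<otimes> h \<in> H" "c (inv x \<otimes> h) \<in> Z"
      using R(3) hG by blast
    have xG: "x \<in> carrier G" using x(1) R(2) by blast
    \<comment> \<open>The covering points are only known to lie in \<open>carrier G\<close>;
      membership of \<open>x\<close> in \<open>H\<close> follows from x = h (x^-1 h)^-1.\<close>
    have "h \<otimes> inv (inv x \<otimes> h) \<in> H"
      by (intro subgroup.m_closed[OF open_subgroupD(1)[OF H]]
          subgroup.m_inv_closed[OF open_subgroupD(1)[OF H]] h x(2))
    then have xH: "x \<in> H"
      using xG hG by (simp add: inv_mult_group m_assoc[symmetric])
    have "x \<otimes> (inv x \<otimes> h) = h" using xG hG by (simp add: m_assoc[symmetric])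
    then have "c h - (c x + twist x (c (inv x \<otimes> h))) \<in> Z"
      using cocycD[OF c xH x(2)] by simp
    then have "c h - (c x + twist x (c (inv x \<otimes> h))) + twist x (c (inv x \<otimes> h)) \<in> Z"
      using twist_Z[OF xG x(3)] by blast
    then have "c h - c x \<in> Z" by simp
    then have "of_int p ^ n * (c h - c x) + of_int p ^ n * c x \<in> Z"
      using Z_add[OF Z_mult[OF Z_p]] n x(1) by blast
    then show ?thesis by (simp add: algebra_simps)
  qed
  then show ?thesis by blast
qed

text \<open>If \<open>c u\<close> is integral then \<open>c (h \<otimes> u)\<close> is congruent to
  \<open>c h\<close>, so vanishing near the identity gives local constancy everywhere.\<close>

lemma S_cocycle_openin:
  assumes H: "open_subgroup G T H" and c: "S_cocycle H c"
  shows "openin T {h \<in> H. c h - a \<in> Z}"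
proof (rule openin_if_near)
  show "{h \<in> H. c h - a \<in> Z} \<subseteq> carrier G"
    using open_subgroupD(4)[OF H] by blast
  fix h assume "h \<in> {h \<in> H. c h - a \<in> Z}"
  then have h: "h \<in> H" "c h - a \<in> Z" by auto
  show "near (\<lambda>u. h \<otimes> u \<in> {h \<in> H. c h - a \<in> Z})"
  proof (rule near_mono[OF S_cocycle_near[OF c]])
    fix u assume u: "u \<in> H \<and> c u \<in> Z"
    have "(c (h \<otimes> u) - (c h + twist h (c u))) + twist h (c u) + (c h - a) \<in> Z"
      using u h cocycD[OF c] twist_Z[OF open_subgroupD(4)[OF H h(1)]] by blast
    then have "c (h \<otimes> u) - a \<in> Z" by (simp add: algebra_simps)
    then show "h \<otimes> u \<in> {h \<in> H. c h - a \<in> Z}"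
      using subgroup.m_closed[OF open_subgroupD(1)[OF H]] h(1) u by simp
  qed
qed

text \<open>Division by \<open>p ^ n\<close> embeds Z/p^n(1) in Q/Z_(p);
  \<open>Zmod_of_S_cocycle\<close> is the converse passage.\<close>

lemma S_cocycle_of_Zmod:
  assumes H: "open_subgroup G T H" and e: "cocycle1 G T H (Zmod p n) (Zmod_act p n \<theta>) e"
  shows "S_cocycle H (\<lambda>h. of_int (e h) / of_int p ^ n)" (is "S_cocycle H ?c")
proof -
  have mult: "?c (h \<otimes> k) - (?c h + twist h (?c k)) \<in> Z" if hk: "h \<in> H" "k \<in> H" for h k
  proof -
    have "e (h \<otimes> k) = (e h + \<theta> h n * e k) mod p ^ n"
      using e hk by (simp add: cocycle1_def Zmod_def Zmod_act_def mod_simps)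
    then have "p ^ n dvd e (h \<otimes> k) - (e h + \<theta> h n * e k)"
      by (simp add: mod_eq_dvd_iff[symmetric])
    then have "of_int (e (h \<otimes> k) - (e h + \<theta> h n * e k)) / of_int p ^ n \<in> Z"
      unfolding Z_of_int_div .
    then have "of_int (e (h \<otimes> k) - (e h + \<theta> h n * e k)) / of_int p ^ n
       + (of_int (\<theta> h n) * ?c k - twist h (?c k)) \<in> Z"
      using twist_residue[OF open_subgroupD(4)[OF H hk(1)]] by blast
    then show ?thesis by (simp add: diff_divide_distrib add_divide_distrib algebra_simps)
  qed
  have one: "?c \<one> \<in> Z"
    using twisted_hom_one[of ?c] mult[of \<one> \<one>] open_subgroupD(3)[OF H] by simp
  have "near (\<lambda>h. h \<in> H \<and> ?c h \<in> Z)"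
  proof (rule nearI)
    show "openin T {h \<in> H. e h = e \<one>}" using e unfolding cocycle1_def by blast
  qed (use open_subgroupD(3)[OF H] one in auto)
  then show ?thesis using mult unfolding S_cocycle_def by blast
qed

text \<open>Representatives in \<open>{0..<p ^ n}\<close> are unique, so the cocycle congruence
  becomes an equation between residues, and the level sets of \<open>e\<close> are those of
  \<open>c\<close> modulo Z_(p).\<close>

lemma Zmod_of_S_cocycle:
  assumes H: "open_subgroup G T H" and c: "S_cocycle H c"
    and n: "\<And>h. h \<in> H \<Longrightarrow> of_int p ^ n * c h \<in> Z"
  shows "\<exists>e. cocycle1 G T H (Zmod p n) (Zmod_act p n \<theta>) e
      \<and> (\<forall>h\<in>H. c h - of_int (e h) / of_int p ^ n \<in> Z)"
proof -
  have "\<forall>h\<in>H. \<exists>a. 0 \<le> a \<and> a < p ^ n \<and> c h - of_int a / of_int p ^ n \<in> Z"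
    using level_residue n by blast
  then obtain e where e: "\<And>h. h \<in> H \<Longrightarrow> 0 \<le> e h \<and> e h < p ^ n \<and> c h - of_int (e h) / of_int p ^ n \<in> Z"
    by metis
  have mult: "e (h \<otimes> k) = (e h + \<theta> h n * e k) mod p ^ n" if hk: "h \<in> H" "k \<in> H" for h k
  proof -
    let ?r = "\<lambda>h. of_int (e h) / of_int p ^ n :: rat"
    have hG: "h \<in> carrier G" using open_subgroupD(4)[OF H hk(1)] .
    have hkH: "h \<otimes> k \<in> H" using subgroup.m_closed[OF open_subgroupD(1)[OF H]] hk by blast
    have "(c (h \<otimes> k) - (c h + twist h (c k))) - (c (h \<otimes> k) - ?r (h \<otimes> k)) + (c h - ?r h)
      + (twist h (c k) - twist h (?r k)) - (of_int (\<theta> h n) * ?r k - twist h (?r k)) \<in> Z"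
      using e[OF hkH] e[OF hk(1)] e[OF hk(2)]
      by (intro Z_diff[OF Z_add[OF Z_add[OF Z_diff[OF cocycD[OF c hk]]]] twist_residue[OF hG]]
          twist_cong[OF hG]) blast+
    then have "of_int (e (h \<otimes> k) - (e h + \<theta> h n * e k)) / of_int p ^ n \<in> Z"
      by (simp add: diff_divide_distrib add_divide_distrib algebra_simps)
    then have "e (h \<otimes> k) mod p ^ n = (e h + \<theta> h n * e k) mod p ^ n"
      unfolding Z_of_int_div by (simp add: mod_eq_dvd_iff)
    then show ?thesis using e[OF hkH] by simp
  qed
  have open_e: "openin T {h \<in> H. e h = a}" for a
  proof (cases "0 \<le> a \<and> a < p ^ n")
    case True
    have "{h \<in> H. e h = a} = {h \<in> H. c h - of_int a / of_int p ^ n \<in> Z}"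
      using e residue_unique[of a n] True by blast
    then show ?thesis using S_cocycle_openin[OF H c] by simp
  next
    case False
    then have "{h \<in> H. e h = a} = {}" using e by blast
    then show ?thesis by (simp only: openin_empty)
  qed
  have "cocycle1 G T H (Zmod p n) (Zmod_act p n \<theta>) e"
    unfolding cocycle1_def
    using e mult open_e by (simp add: Zmod_def Zmod_act_def mod_simps)
  then show ?thesis using e by blast
qed

text \<open>Inside Q/Z_(p), the reduction from Z/p^(m+1)(1) to Z/p(1) is multiplication by
  \<open>p ^ m\<close>, hence the modulus \<open>Suc m\<close> below. The lift from formal Hilbert
  90 is correct only up to a coboundary, which is then removed.\<close>

lemma H90_lift:
  assumes H90: "formal_H90 p G T \<theta>" and H: "open_subgroup G T H" and d: "S_cocycle H d"
    and pd: "\<And>h. h \<in> H \<Longrightarrow> of_int p * d h \<in> Z"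
  shows "\<exists>e. S_cocycle H e \<and> (\<forall>h\<in>H. of_int p ^ m * e h - d h \<in> Z)"
proof -
  obtain e1 where e1: "cocycle1 G T H (Zmod p 1) (Zmod_act p 1 \<theta>) e1"
    "\<forall>h\<in>H. d h - of_int (e1 h) / of_int p ^ 1 \<in> Z"
    using Zmod_of_S_cocycle[OF H d, of 1] pd by auto
  obtain c' where c': "cocycle1 G T H (Zmod p (Suc m)) (Zmod_act p (Suc m) \<theta>) c'"
    "coboundary1 H (Zmod p 1) (Zmod_act p 1 \<theta>) (\<lambda>h. (c' h - e1 h) mod p)"
    using H90 H e1(1) unfolding formal_H90_def by (metis le_add1 plus_1_eq_Suc)
  obtain s where s: "s \<in> carrier (Zmod p 1)"
    "\<And>h. h \<in> H \<Longrightarrow> (c' h - e1 h) mod p = Zmod_act p 1 \<theta> h s \<otimes>\<^bsub>Zmod p 1\<^esub> inv\<^bsub>Zmod p 1\<^esub> s"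
    using c'(2) unfolding coboundary1_def by blast
  have s': "(c' h - e1 h) mod p = (\<theta> h 1 * s - s) mod p" if "h \<in> H" for h
    using s(2)[OF that] inv_Zmod[OF p_gt_0 s(1)]
    by (simp add: Zmod_act_def) (simp add: Zmod_def mod_simps)
  let ?s = "of_int s / of_int p ^ Suc m :: rat"
  let ?c = "\<lambda>h. of_int (c' h) / of_int p ^ Suc m :: rat"
  \<comment> \<open>The error is the coboundary of \<open>s / p\<close>, and this is
    \<open>p ^ m\<close> times the coboundary of \<open>?s\<close>. Subtracting the latter makes the
    lift exact.\<close>
  define e where "e = (\<lambda>h. ?c h + (- 1) * (twist h ?s - ?s))"
  have "S_cocycle H e"
    unfolding e_def
    by (intro S_cocycle_add[OF H] S_cocycle_scale[OF H] S_cocycle_coboundary[OF H] S_cocycle_of_Zmod[OF H] c'(1)) simp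
  moreover have "of_int p ^ m * e h - d h \<in> Z" if h: "h \<in> H" for h
  proof -
    have hG: "h \<in> carrier G" using open_subgroupD(4)[OF H h] .
    have ps: "of_int p ^ m * ?s = of_int s / of_int p" "of_int p ^ m * ?c h = of_int (c' h) / of_int p"
      by simp_all
    have 1: "twist h (of_int s / of_int p) - of_int p ^ m * twist h ?s \<in> Z"
      using twist_scale[OF hG Z_p[of m], of ?s] unfolding ps .
    have 2: "of_int (\<theta> h 1) * (of_int s / of_int p) - twist h (of_int s / of_int p) \<in> Z"
      using twist_residue[OF hG, of 1 s] by simp
    have "p dvd (c' h - e1 h) - (\<theta> h 1 * s - s)"
      using s'[OF h] by (simp add: mod_eq_dvd_iff)
    then have 3: "of_int ((c' h - e1 h) - (\<theta> h 1 * s - s)) / of_int p \<in> Z"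
      using Z_of_int_div[of "(c' h - e1 h) - (\<theta> h 1 * s - s)" 1] by (simp only: power_one_right)
    have 4: "d h - of_int (e1 h) / of_int p \<in> Z" using e1(2) h by simp
    have "of_int ((c' h - e1 h) - (\<theta> h 1 * s - s)) / of_int p
       + (twist h (of_int s / of_int p) - of_int p ^ m * twist h ?s)
       + (of_int (\<theta> h 1) * (of_int s / of_int p) - twist h (of_int s / of_int p))
       - (d h - of_int (e1 h) / of_int p) \<in> Z"
      by (rule Z_diff[OF Z_add[OF Z_add[OF 3 1] 2] 4])
    then have "of_int (c' h) / of_int p - of_int p ^ m * twist h ?s + of_int s / of_int p - d h \<in> Z"
      by (simp add: diff_divide_distrib add_divide_distrib algebra_simps)
    moreover have "of_int p ^ m * e h = of_int (c' h) / of_int p - of_int p ^ m * twist h ?s + of_int s / of_int p"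
      unfolding e_def distrib_left ps right_diff_distrib by (simp add: algebra_simps)
    ultimately show ?thesis by (simp only:)
  qed
  ultimately show ?thesis by blast
qed

text \<open>Induction on the exponent killing \<open>c\<close>. If \<open>p ^ Suc n\<close> kills
  \<open>c\<close>, then \<open>p\<close> kills \<open>p ^ n * c\<close>, so \<open>H90_lift\<close>
  gives \<open>e\<close> with \<open>p ^ Suc n * e\<close> congruent to \<open>p ^ n * c\<close>.
  Now \<open>c - p * e\<close> is killed by \<open>p ^ n\<close>; if \<open>d\<close> divides it,
  then \<open>d + e\<close> divides \<open>c\<close>.\<close>

lemma S_cocycle_divisible:
  assumes H90: "formal_H90 p G T \<theta>" and H: "open_subgroup G T H" and c: "S_cocycle H c"
  shows "\<exists>d. S_cocycle H d \<and> (\<forall>h\<in>H. of_int p * d h - c h \<in> Z)"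
proof -
  obtain n where "\<forall>h\<in>H. of_int p ^ n * c h \<in> Z"
    using S_cocycle_level[OF H c] by blast
  then show ?thesis
    using c
  proof (induction n arbitrary: c)
    case 0
    then show ?case
      using S_cocycle_zero[OF H, of "\<lambda>_. 0"] Z_uminus by (intro exI[of _ "\<lambda>_. 0"]) auto
  next
    case (Suc n)
    have "S_cocycle H (\<lambda>h. of_int p ^ n * c h)"
      by (intro S_cocycle_scale[OF H] Suc.prems) simp
    moreover have "of_int p * (of_int p ^ n * c h) \<in> Z" if "h \<in> H" for h
      using Suc.prems(1) that by (simp add: mult.assoc)
    ultimately obtain e where e: "S_cocycle H e"
      "\<forall>h\<in>H. of_int p ^ Suc n * e h - of_int p ^ n * c h \<in> Z"
      using H90_lift[OF H90 H] by blast
    define c2 where "c2 = (\<lambda>h. c h + (- of_int p) * e h)"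
    have "S_cocycle H c2"
      unfolding c2_def using Z_simps(1)[of "- p"]
      by (intro S_cocycle_add[OF H] S_cocycle_scale[OF H] Suc.prems e(1)) simp
    moreover have "\<forall>h\<in>H. of_int p ^ n * c2 h \<in> Z"
    proof
      fix h assume "h \<in> H"
      then have "- (of_int p ^ Suc n * e h - of_int p ^ n * c h) \<in> Z" using e(2) by blast
      then show "of_int p ^ n * c2 h \<in> Z" by (simp add: c2_def algebra_simps)
    qed
    ultimately obtain d where d: "S_cocycle H d" "\<forall>h\<in>H. of_int p * d h - c2 h \<in> Z"
      using Suc.IH by blast
    have "S_cocycle H (\<lambda>h. d h + e h)" by (rule S_cocycle_add[OF H d(1) e(1)])
    moreover have "\<forall>h\<in>H. of_int p * (d h + e h) - c h \<in> Z"
      using d(2) by (simp add: c2_def algebra_simps)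
    ultimately show ?case by blast
  qed
qed

text \<open>Repeated division by \<open>p\<close> makes \<open>c\<close> the zeroth entry of a
  cocycle with values in B, the input required by \<open>induced_admissible\<close>.\<close>

lemma S_cocycle_tower:
  assumes H90: "formal_H90 p G T \<theta>" and H: "open_subgroup G T H" and c: "S_cocycle H c"
  shows "\<exists>cs. cs 0 = c \<and> (\<forall>i. S_cocycle H (cs i)) \<and> (\<forall>i. \<forall>h\<in>H. of_int p * cs (Suc i) h - cs i h \<in> Z)"
proof -
  have "\<exists>cs. \<forall>i. (S_cocycle H (cs i) \<and> (i = 0 \<longrightarrow> cs i = c))
      \<and> (\<forall>h\<in>H. of_int p * cs (Suc i) h - cs i h \<in> Z)"
    by (rule dependent_nat_choice) (use c S_cocycle_divisible[OF H90 H] in auto)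
  then show ?thesis by blast
qed

lemma S_cocycle_trivialised:
  assumes "formal_H90 p G T \<theta>" "open_subgroup G T H" "S_cocycle H c"
  shows "\<exists>F. admissible F \<and> (\<forall>h\<in>H. twisted (translate h F - F) \<and> (F h 0 - F \<one> 0) - c h \<in> Z)"
  using S_cocycle_tower[OF assms] induced_admissible[OF assms(2)] by metis

section \<open>Q/Z_(p) as a group of cosets\<close>

definition coset :: "rat \<Rightarrow> rat set" where
  "coset q = {w. \<exists>z\<in>Z. w = q + z}"

lemma mem_coset: "w \<in> coset q \<longleftrightarrow> w - q \<in> Z"
  unfolding coset_def by (auto intro!: bexI[of _ "w - q"])

lemma coset_eq: "coset q = coset r \<longleftrightarrow> q - r \<in> Z"
proof
  assume "coset q = coset r"
  then have "q \<in> coset r" using mem_coset[of q q] by simp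
  then show "q - r \<in> Z" by (simp add: mem_coset)
next
  assume qr: "q - r \<in> Z"
  show "coset q = coset r"
    using Z_trans[OF _ qr] Z_trans[OF _ Z_sym[OF qr]] by (auto simp: mem_coset)
qed

lemma carrier_S: "carrier (S_grp p) = range coset"
  unfolding S_grp_def S_carrier_def coset_def by auto

lemma mult_S: "coset q \<otimes>\<^bsub>S_grp p\<^esub> coset r = coset (q + r)"
proof -
  have "(\<exists>a\<in>coset q. \<exists>b\<in>coset r. w = a + b) \<longleftrightarrow> w \<in> coset (q + r)" for w
  proof
    assume "\<exists>a\<in>coset q. \<exists>b\<in>coset r. w = a + b"
    then obtain a b where "a - q \<in> Z" "b - r \<in> Z" "w = a + b" by (auto simp: mem_coset)
    then have "(a - q) + (b - r) \<in> Z" by blast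
    then show "w \<in> coset (q + r)" using \<open>w = a + b\<close> by (simp add: mem_coset algebra_simps)
  next
    assume "w \<in> coset (q + r)"
    then have "q \<in> coset q" "w - q \<in> coset r" by (simp_all add: mem_coset algebra_simps)
    then show "\<exists>a\<in>coset q. \<exists>b\<in>coset r. w = a + b"
      by (intro bexI[of _ q] bexI[of _ "w - q"]) simp_all
  qed
  then show ?thesis unfolding S_grp_def S_add_def by auto
qed

text \<open>\<open>S_act\<close> ranges over all representatives and all sufficient exponents;
  \<open>twist_cong\<close> and \<open>twist_eq\<close> show that they all lead to one
  class.\<close>

lemma S_act_coset:
  assumes "g \<in> carrier G"
  shows "S_act p \<theta> g (coset q) = coset (twist g q)"
proof (intro equalityI subsetI)
  fix w assume "w \<in> S_act p \<theta> g (coset q)"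
  then obtain r k z where *: "r - q \<in> Z" "z \<in> Z" "of_int p ^ k * r \<in> Z" "w = of_int (\<theta> g k) * r + z"
    unfolding S_act_def by (auto simp: mem_coset)
  have "(of_int (\<theta> g k) * r - twist g r) + (twist g r - twist g q) + z \<in> Z"
    using twist_eq[OF assms *(3)] twist_cong[OF assms *(1)] *(2) by blast
  then show "w \<in> coset (twist g q)" unfolding *(4) mem_coset by (simp add: algebra_simps)
next
  fix w assume "w \<in> coset (twist g q)"
  then have w: "w - twist g q \<in> Z" by (simp add: mem_coset)
  obtain k where k: "of_int p ^ k * q \<in> Z" using ex_level by blast
  define z where "z = w - of_int (\<theta> g k) * q"
  have "(w - twist g q) - (of_int (\<theta> g k) * q - twist g q) \<in> Z"
    using w twist_eq[OF assms k] by blast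
  then have "z \<in> Z" by (simp add: z_def)
  moreover have "q \<in> coset q" "of_int (p ^ k) * q \<in> Z" "w = of_int (\<theta> g k) * q + z"
    using k by (simp_all add: mem_coset z_def)
  ultimately show "w \<in> S_act p \<theta> g (coset q)" unfolding S_act_def by blast
qed

end

section \<open>Construction of the Hilbert 90 module\<close>

locale oriented_H90 = oriented p G T \<theta>
  for p :: int and G :: "('g, 'b) monoid_scheme" (structure) and T :: "'g topology"
    and \<theta> :: "'g \<Rightarrow> nat \<Rightarrow> int" +
  assumes H90: "formal_H90 p G T \<theta>"
begin

text \<open>Indices that are not cocycles on open subgroups, such as \<open>({}, \<lambda>_. q)\<close>, code the functions
  \<open>base q\<close> that represent the torsion.\<close>
definition trivialiser :: "'g set \<Rightarrow> ('g \<Rightarrow> rat) \<Rightarrow> 'g \<Rightarrow> nat \<Rightarrow> rat" where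
  "trivialiser H c = (if open_subgroup G T H \<and> S_cocycle H c
     then (SOME F. admissible F \<and> (\<forall>h\<in>H. twisted (translate h F - F) \<and> (F h 0 - F \<one> 0) - c h \<in> Z))
     else base (c \<one>))"

lemma trivialiser_S_cocycle:
  assumes "open_subgroup G T H" "S_cocycle H c"
  shows "admissible (trivialiser H c)" "h \<in> H \<Longrightarrow> twisted (translate h (trivialiser H c) - trivialiser H c)"
    "h \<in> H \<Longrightarrow> (trivialiser H c h 0 - trivialiser H c \<one> 0) - c h \<in> Z"
proof -
  have "admissible (trivialiser H c) \<and> (\<forall>h\<in>H. twisted (translate h (trivialiser H c) - trivialiser H c)
      \<and> (trivialiser H c h 0 - trivialiser H c \<one> 0) - c h \<in> Z)"
    using someI_ex[OF S_cocycle_trivialised[OF H90 assms]] assms by (simp add: trivialiser_def)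
  then show "admissible (trivialiser H c)" "h \<in> H \<Longrightarrow> twisted (translate h (trivialiser H c) - trivialiser H c)"
    "h \<in> H \<Longrightarrow> (trivialiser H c h 0 - trivialiser H c \<one> 0) - c h \<in> Z"
    by blast+
qed

lemma trivialiser_empty: "trivialiser {} c = base (c \<one>)"
  unfolding trivialiser_def open_subgroup_def subgroup_def by simp

lemma admissible_trivialiser: "admissible (trivialiser H c)"
  using trivialiser_S_cocycle(1) admissible_base by (cases "open_subgroup G T H \<and> S_cocycle H c") (auto simp: trivialiser_def)

text \<open>Translations, shifts and scalings commute with each other, so every composite of them
  can be brought to this order.\<close>

fun gen_term :: "rat \<times> nat \<times> 'g \<times> 'g set \<times> ('g \<Rightarrow> rat) \<Rightarrow> 'g \<Rightarrow> nat \<Rightarrow> rat" where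
  "gen_term (z, k, g, H, c) = scale z (shift k (translate g (trivialiser H c)))"

definition gen_indices :: "(rat \<times> nat \<times> 'g \<times> 'g set \<times> ('g \<Rightarrow> rat)) set" where
  "gen_indices = Z \<times> UNIV \<times> carrier G \<times> UNIV \<times> UNIV"

text \<open>Sums are indexed by lists so that \<open>generator_lists_lepoll\<close> bounds the size
  of the span.\<close>

definition gen_span :: "('g \<Rightarrow> nat \<Rightarrow> rat) set" where
  "gen_span = {sum_list (map gen_term L) | L. set L \<subseteq> gen_indices}"

lemma gen_span_0: "0 \<in> gen_span"
  unfolding gen_span_def by (auto intro!: exI[of _ "[]"])

lemma gen_span_add:
  assumes "F \<in> gen_span" "F' \<in> gen_span"
  shows "F + F' \<in> gen_span"
proof -
  obtain L L' where "F = sum_list (map gen_term L)" "set L \<subseteq> gen_indices"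
    "F' = sum_list (map gen_term L')" "set L' \<subseteq> gen_indices"
    using assms unfolding gen_span_def by blast
  then show ?thesis unfolding gen_span_def by (auto intro!: exI[of _ "L @ L'"])
qed

text \<open>Used for scaling, shifting and translating: each sends a generator to a generator with
  an adjusted index, and additivity extends this to sums.\<close>

lemma gen_span_map:
  assumes F: "F \<in> gen_span" and h: "h 0 = 0" "\<And>F F'. h (F + F') = h F + h F'"
    and gen_term: "\<And>a. a \<in> gen_indices \<Longrightarrow> \<exists>b\<in>gen_indices. h (gen_term a) = gen_term b"
  shows "h F \<in> gen_span"
proof -
  obtain L where L: "F = sum_list (map gen_term L)" "set L \<subseteq> gen_indices"
    using F unfolding gen_span_def by blast
  obtain b where b: "\<And>a. a \<in> gen_indices \<Longrightarrow> b a \<in> gen_indices \<and> h (gen_term a) = gen_term (b a)"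
    using gen_term by metis
  have "h F = sum_list (map gen_term (map b L))"
    using L(2) b unfolding L(1) additive_sum_list[of h, OF h] map_map
    by (intro arg_cong[of _ _ sum_list] map_cong) auto
  moreover have "set (map b L) \<subseteq> gen_indices" using L(2) b by auto
  ultimately show ?thesis unfolding gen_span_def by blast
qed

lemma gen_span_scale:
  assumes "F \<in> gen_span" "z \<in> Z"
  shows "scale z F \<in> gen_span"
proof (rule gen_span_map[where h = "scale z", OF assms(1)])
  fix a assume "a \<in> gen_indices"
  then obtain y k g H c where a: "a = (y, k, g, H, c)" "y \<in> Z" "g \<in> carrier G"
    unfolding gen_indices_def by auto
  then have "(z * y, k, g, H, c) \<in> gen_indices" "scale z (gen_term a) = gen_term (z * y, k, g, H, c)"
    using assms(2) by (auto simp: gen_indices_def scale_scale)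
  then show "\<exists>b\<in>gen_indices. scale z (gen_term a) = gen_term b" by blast
qed (simp_all add: op_zero op_add)

lemma gen_span_shift:
  assumes "F \<in> gen_span"
  shows "shift l F \<in> gen_span"
proof (rule gen_span_map[where h = "shift l", OF assms])
  fix a assume "a \<in> gen_indices"
  then obtain y k g H c where a: "a = (y, k, g, H, c)" "y \<in> Z" "g \<in> carrier G"
    unfolding gen_indices_def by auto
  then have "(y, l + k, g, H, c) \<in> gen_indices" "shift l (gen_term a) = gen_term (y, l + k, g, H, c)"
    by (auto simp: gen_indices_def shift_scale shift_shift)
  then show "\<exists>b\<in>gen_indices. shift l (gen_term a) = gen_term b" by blast
qed (simp_all add: op_zero op_add)

lemma gen_span_translate:
  assumes "F \<in> gen_span" "h \<in> carrier G"
  shows "translate h F \<in> gen_span"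
proof (rule gen_span_map[where h = "translate h", OF assms(1)])
  fix a assume "a \<in> gen_indices"
  then obtain y k g H c where a: "a = (y, k, g, H, c)" "y \<in> Z" "g \<in> carrier G"
    unfolding gen_indices_def by auto
  then have "(y, k, h \<otimes> g, H, c) \<in> gen_indices" "translate h (gen_term a) = gen_term (y, k, h \<otimes> g, H, c)"
    using assms(2) by (auto simp: gen_indices_def translate_scale translate_shift translate_mult)
  then show "\<exists>b\<in>gen_indices. translate h (gen_term a) = gen_term b" by blast
qed (simp_all add: op_zero op_add)

lemma gen_span_uminus: "F \<in> gen_span \<Longrightarrow> - F \<in> gen_span"
  using gen_span_scale[of F "- 1"] by (simp add: scale_minus)

lemma gen_span_diff: "F \<in> gen_span \<Longrightarrow> F' \<in> gen_span \<Longrightarrow> F - F' \<in> gen_span"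
  using gen_span_add[of F "- F'"] gen_span_uminus by simp

lemma gen_span_sum: "(\<And>i. i \<in> I \<Longrightarrow> f i \<in> gen_span) \<Longrightarrow> sum f I \<in> gen_span"
  by (induction I rule: infinite_finite_induct) (auto intro: gen_span_0 gen_span_add)

text \<open>Translation by the identity leaves the function unchanged on the carrier and sets it to
  0 elsewhere; in this form it is itself a generator.\<close>

lemma gen_span_trivialiser: "translate \<one> (trivialiser H c) \<in> gen_span"
proof -
  have "translate \<one> (trivialiser H c) = sum_list (map gen_term [(1, 0, \<one>, H, c)])"
    by (simp add: fun_eq_iff)
  then show ?thesis unfolding gen_span_def gen_indices_def by fastforce
qed

lemma gen_span_admissible:
  assumes "F \<in> gen_span"
  shows "admissible F"
proof -
  obtain L where L: "F = sum_list (map gen_term L)" "set L \<subseteq> gen_indices"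
    using assms unfolding gen_span_def by blast
  show ?thesis
    using L(2) unfolding L(1)
  proof (induction L)
    case (Cons a L)
    obtain y k g H c where a: "a = (y, k, g, H, c)" "y \<in> Z" "g \<in> carrier G"
      using Cons.prems unfolding gen_indices_def by auto
    then have "admissible (gen_term a)" by (simp add: admissible_scale admissible_shift admissible_translate admissible_trivialiser)
    moreover have "admissible (sum_list (map gen_term L))" using Cons by simp
    ultimately show ?case unfolding list.map sum_list.Cons by (rule admissible_add)
  qed (simp add: admissible_0)
qed

lemma gen_span_tower: "F \<in> gen_span \<Longrightarrow> tower F"
  using gen_span_admissible admissible_tower by blast

section \<open>The quotient module and its carrier\<close>

definition code :: "('g \<Rightarrow> nat \<Rightarrow> rat) \<Rightarrow> 'g set \<times> nat" where
  "code = (SOME e. inj_on e gen_span)"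

lemma inj_code: "inj_on code gen_span"
proof -
  have "gen_span \<lesssim> (UNIV :: (rat \<times> nat \<times> 'g \<times> 'g set \<times> ('g \<Rightarrow> rat)) list set)"
    by (rule subset_image_lepoll[of _ "\<lambda>L. sum_list (map gen_term L)"]) (auto simp: gen_span_def)
  then have "gen_span \<lesssim> (UNIV :: ('g set \<times> nat) set)"
    using generator_lists_lepoll lepoll_trans by blast
  then have "\<exists>e :: ('g \<Rightarrow> nat \<Rightarrow> rat) \<Rightarrow> 'g set \<times> nat. inj_on e gen_span"
    unfolding lepoll_def by blast
  then show ?thesis unfolding code_def by (rule someI_ex)
qed

text \<open>The quotient of \<open>gen_span\<close> by the null functions is realised inside \<open>'g set \<times> nat\<close> by coding
  one chosen representative of each class.\<close>
definition quot_class :: "('g \<Rightarrow> nat \<Rightarrow> rat) \<Rightarrow> 'g set \<times> nat" where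
  "quot_class F = code (SOME F'. F' \<in> gen_span \<and> null (F' - F))"

lemma quot_class_eq:
  assumes "F \<in> gen_span" "F' \<in> gen_span"
  shows "quot_class F = quot_class F' \<longleftrightarrow> null (F - F')"
proof
  define r where "r = (\<lambda>Y. SOME X. X \<in> gen_span \<and> null (X - Y))"
  have r: "r Y \<in> gen_span \<and> null (r Y - Y)" if "Y \<in> gen_span" for Y
    unfolding r_def by (rule someI[of "\<lambda>X. X \<in> gen_span \<and> null (X - Y)" Y]) (simp add: that null_0)
  show "null (F - F')" if "quot_class F = quot_class F'"
  proof -
    have "code (r F) = code (r F')" using that unfolding quot_class_def r_def .
    then have "r F = r F'"
      using inj_onD[OF inj_code] r assms by blast
    then have "null (r F - F)" "null (r F - F')"
      using r[OF assms(1)] r[OF assms(2)] by simp_all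
    then have "null ((r F - F') - (r F - F))" by (rule null_diff[rotated])
    then show ?thesis by simp
  qed
  show "quot_class F = quot_class F'" if n: "null (F - F')"
  proof -
    have "null (X - F) = null (X - F')" for X
      using null_add[OF _ n, of "X - F"] null_diff[OF _ n, of "X - F'"] by auto
    then show ?thesis unfolding quot_class_def by simp
  qed
qed

definition lift_of :: "'g set \<times> nat \<Rightarrow> 'g \<Rightarrow> nat \<Rightarrow> rat" where
  "lift_of x = (SOME F. F \<in> gen_span \<and> quot_class F = x)"

lemma lift_of:
  assumes "x \<in> quot_class ` gen_span"
  shows "lift_of x \<in> gen_span" "quot_class (lift_of x) = x"
proof -
  have "\<exists>F. F \<in> gen_span \<and> quot_class F = x" using assms by blast
  then have "lift_of x \<in> gen_span \<and> quot_class (lift_of x) = x" unfolding lift_of_def by (rule someI_ex)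
  then show "lift_of x \<in> gen_span" "quot_class (lift_of x) = x" by auto
qed

lemma lift_of_quot_class:
  assumes "F \<in> gen_span"
  shows "lift_of (quot_class F) \<in> gen_span" "null (lift_of (quot_class F) - F)"
  using lift_of[of "quot_class F"] quot_class_eq[of "lift_of (quot_class F)" F] assms by auto

definition quot :: "('g set \<times> nat) monoid" where
  "quot = \<lparr>carrier = quot_class ` gen_span, monoid.mult = (\<lambda>x y. quot_class (lift_of x + lift_of y)), one = quot_class 0\<rparr>"

definition quot_act :: "'g \<Rightarrow> 'g set \<times> nat \<Rightarrow> 'g set \<times> nat" where
  "quot_act g x = quot_class (translate g (lift_of x))"

lemma quot_simps: "carrier quot = quot_class ` gen_span" "\<one>\<^bsub>quot\<^esub> = quot_class 0"
  by (simp_all add: quot_def)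

lemma mult_quot_class:
  assumes "F \<in> gen_span" "F' \<in> gen_span"
  shows "quot_class F \<otimes>\<^bsub>quot\<^esub> quot_class F' = quot_class (F + F')"
proof -
  have "null ((lift_of (quot_class F) - F) + (lift_of (quot_class F') - F'))"
    by (intro null_add lift_of_quot_class assms)
  then have "null ((lift_of (quot_class F) + lift_of (quot_class F')) - (F + F'))"
    by (simp add: algebra_simps)
  then show ?thesis
    using quot_class_eq[of "lift_of (quot_class F) + lift_of (quot_class F')" "F + F'"] lift_of_quot_class(1) assms
    by (simp add: quot_def gen_span_add)
qed

lemma op_diff: "translate g (F - F') = translate g F - translate g F'" "scale z (F - F') = scale z F - scale z F'"
  by (auto simp: fun_eq_iff translate_def right_diff_distrib)

lemma act_quot_class:
  assumes "F \<in> gen_span" "g \<in> carrier G"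
  shows "quot_act g (quot_class F) = quot_class (translate g F)"
proof -
  have "null (translate g (lift_of (quot_class F)) - translate g F)"
    using null_translate[OF lift_of_quot_class(2)[OF assms(1)] assms(2)] by (simp add: op_diff)
  then show ?thesis
    using quot_class_eq[of "translate g (lift_of (quot_class F))" "translate g F"] lift_of_quot_class(1) assms
    by (simp add: quot_act_def gen_span_translate)
qed

lemma comm_group_quot: "comm_group quot"
proof (rule comm_groupI)
  fix x y z assume "x \<in> carrier quot" "y \<in> carrier quot" "z \<in> carrier quot"
  then obtain X Y W where "X \<in> gen_span" "Y \<in> gen_span" "W \<in> gen_span" "x = quot_class X" "y = quot_class Y" "z = quot_class W"
    by (auto simp: quot_simps)
  then show "x \<otimes>\<^bsub>quot\<^esub> y \<otimes>\<^bsub>quot\<^esub> z = x \<otimes>\<^bsub>quot\<^esub> (y \<otimes>\<^bsub>quot\<^esub> z)"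
    "x \<otimes>\<^bsub>quot\<^esub> y = y \<otimes>\<^bsub>quot\<^esub> x" "\<one>\<^bsub>quot\<^esub> \<otimes>\<^bsub>quot\<^esub> x = x" "x \<otimes>\<^bsub>quot\<^esub> y \<in> carrier quot"
    by (simp_all add: quot_simps mult_quot_class gen_span_add gen_span_0 add_ac)
next
  fix x assume "x \<in> carrier quot"
  then obtain X where X: "X \<in> gen_span" "x = quot_class X" by (auto simp: quot_simps)
  then have "quot_class (- X) \<otimes>\<^bsub>quot\<^esub> x = \<one>\<^bsub>quot\<^esub>"
    by (simp add: quot_simps mult_quot_class gen_span_uminus)
  then show "\<exists>y\<in>carrier quot. y \<otimes>\<^bsub>quot\<^esub> x = \<one>\<^bsub>quot\<^esub>"
    using X gen_span_uminus by (auto simp: quot_simps)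
qed (simp add: quot_simps gen_span_0)

lemma inv_quot_class:
  assumes "F \<in> gen_span"
  shows "inv\<^bsub>quot\<^esub> (quot_class F) = quot_class (- F)"
proof -
  interpret M: comm_group quot by (rule comm_group_quot)
  show ?thesis
    by (rule M.inv_equality) (use assms in \<open>simp_all add: quot_simps mult_quot_class gen_span_uminus\<close>)
qed

lemma pow_quot_class:
  assumes "F \<in> gen_span"
  shows "quot_class F [^]\<^bsub>quot\<^esub> (n :: nat) = quot_class (scale (of_nat n) F)"
proof -
  interpret M: comm_group quot by (rule comm_group_quot)
  show ?thesis
  proof (induction n)
    case 0
    have "scale (of_nat 0) F = 0" by (simp add: fun_eq_iff)
    then show ?case by (simp only: M.nat_pow_0 quot_simps)
  next
    case (Suc n)
    have "scale (of_nat n) F + F = scale (of_nat (Suc n)) F"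
      by (simp add: fun_eq_iff distrib_right)
    moreover have "of_nat n \<in> Z" using Z_simps(1)[of "int n"] by simp
    ultimately have "quot_class (scale (of_nat n) F) \<otimes>\<^bsub>quot\<^esub> quot_class F = quot_class (scale (of_nat (Suc n)) F)"
      using mult_quot_class[OF gen_span_scale[OF assms] assms, of "of_nat n"] by simp
    then show ?case unfolding M.nat_pow_Suc Suc.IH .
  qed
qed

lemma discrete_quot: "discrete_module G T quot quot_act"
  unfolding discrete_module_def
proof (intro conjI ballI)
  fix m assume "m \<in> carrier quot"
  then obtain F where F: "F \<in> gen_span" "m = quot_class F" by (auto simp: quot_simps)
  show "quot_act \<one> m = m"
  proof -
    have "null (translate \<one> F - F)" by (rule nullI_Z) simp
    then show ?thesis using F quot_class_eq[of "translate \<one> F" F] by (simp add: act_quot_class gen_span_translate)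
  qed
  show "quot_act g m \<in> carrier quot" if "g \<in> carrier G" for g
    using that F by (simp add: quot_simps act_quot_class gen_span_translate)
  show "quot_act (g \<otimes> h) m = quot_act g (quot_act h m)" if "g \<in> carrier G" "h \<in> carrier G" for g h
    using that F by (simp add: act_quot_class gen_span_translate translate_mult)
  show "quot_act g (m \<otimes>\<^bsub>quot\<^esub> m') = quot_act g m \<otimes>\<^bsub>quot\<^esub> quot_act g m'"
    if "g \<in> carrier G" "m' \<in> carrier quot" for g m'
  proof -
    obtain F' where "F' \<in> gen_span" "m' = quot_class F'" using \<open>m' \<in> carrier quot\<close> by (auto simp: quot_simps)
    then show ?thesis using that F by (simp add: act_quot_class mult_quot_class gen_span_translate gen_span_add op_add)
  qed
  show "openin T {g \<in> carrier G. quot_act g m = m}"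
  proof (rule openin_if_near)
    fix g assume "g \<in> {g \<in> carrier G. quot_act g m = m}"
    then have g: "g \<in> carrier G" "quot_act g m = m" by auto
    \<comment> \<open>For such \<open>u\<close> the difference \<open>translate u F - F\<close> is
      twisted and integral at the identity in level 0, hence null. So \<open>u\<close> fixes the
      class, and the stabiliser is open.\<close>
    have nr: "near (\<lambda>u. twisted (translate u F - F) \<and> (\<forall>x\<in>carrier G. F (x \<otimes> u) 0 - F x 0 \<in> Z))"
      by (intro near_conj admissible_near admissible_near_twisted gen_span_admissible F)
    show "near (\<lambda>u. g \<otimes> u \<in> {g \<in> carrier G. quot_act g m = m})"
    proof (rule near_mono[OF nr])
      fix u assume u: "u \<in> carrier G"
        and "twisted (translate u F - F) \<and> (\<forall>x\<in>carrier G. F (x \<otimes> u) 0 - F x 0 \<in> Z)"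
      then have twist: "twisted (translate u F - F)" and "F (\<one> \<otimes> u) 0 - F \<one> 0 \<in> Z" by blast+
      then have "null (translate u F - F)" unfolding null_def by simp
      then have "quot_act u m = m" using F u quot_class_eq[of "translate u F" F] by (simp add: act_quot_class gen_span_translate)
      moreover have "quot_act (g \<otimes> u) m = quot_act g (quot_act u m)"
        using g(1) u F by (simp add: act_quot_class gen_span_translate translate_mult)
      ultimately show "g \<otimes> u \<in> {g \<in> carrier G. quot_act g m = m}" using g u by simp
    qed
  qed simp
qed (rule comm_group_quot)

lemma quot_divisible:
  assumes "m \<in> carrier quot"
  shows "\<exists>x\<in>carrier quot. x [^]\<^bsub>quot\<^esub> nat p = m"
proof -
  obtain F where F: "F \<in> gen_span" "m = quot_class F" using assms by (auto simp: quot_simps)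
  have "of_nat (nat p) = (of_int p :: rat)" by simp
  then have "null (scale (of_nat (nat p)) (shift 1 F) - F)"
    using null_scale_shift[OF gen_span_tower[OF F(1)], of 1] by (simp only: power_one_right)
  moreover have "of_nat (nat p) \<in> Z" using Z_simps(1)[of "int (nat p)"] by simp
  ultimately have "quot_class (scale (of_nat (nat p)) (shift 1 F)) = m"
    using F quot_class_eq[of "scale (of_nat (nat p)) (shift 1 F)" F] gen_span_scale[OF gen_span_shift[OF F(1)]] by blast
  then have "quot_class (shift 1 F) [^]\<^bsub>quot\<^esub> nat p = m"
    unfolding pow_quot_class[OF gen_span_shift[OF F(1)]] .
  then show ?thesis using F gen_span_shift by (auto simp: quot_simps)
qed

section \<open>Torsion and first cohomology of the module\<close>

text \<open>A null multiple by a power of \<open>p\<close> forces \<open>F\<close> to be twisted, by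
  \<open>twisted_if_scale_p_power\<close>. Conversely, a twisted \<open>F\<close> is killed by any
  power of \<open>p\<close> that makes \<open>F \<one> 0\<close> integral.\<close>

lemma p_primary_quot: "p_primary p quot = quot_class ` {F \<in> gen_span. twisted F}"
proof -
  have "(\<exists>n. quot_class F [^]\<^bsub>quot\<^esub> (nat p ^ n) = \<one>\<^bsub>quot\<^esub>) \<longleftrightarrow> twisted F" if F: "F \<in> gen_span" for F
  proof -
    have "quot_class F [^]\<^bsub>quot\<^esub> (nat p ^ n) = \<one>\<^bsub>quot\<^esub> \<longleftrightarrow> null (scale (of_int p ^ n) F)" for n
      using F quot_class_eq[of "scale (of_int p ^ n) F" 0] gen_span_0 by (simp add: quot_simps pow_quot_class gen_span_scale)
    moreover have "twisted F" if "null (scale (of_int p ^ n) F)" for n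
      using twisted_if_scale_p_power[OF gen_span_tower[OF F]] that unfolding null_def by blast
    moreover have "\<exists>n. null (scale (of_int p ^ n) F)" if "twisted F"
      using twisted_scale[OF that Z_p] ex_level[of "F \<one> 0"] unfolding null_def by simp
    ultimately show ?thesis by blast
  qed
  then show ?thesis unfolding p_primary_def quot_simps by blast
qed

lemma null_sum: "(\<And>i. i \<in> I \<Longrightarrow> null (f i)) \<Longrightarrow> null (sum f I)"
proof (induction I rule: infinite_finite_induct)
  case (insert i I)
  have "null (f i + sum f I)" by (rule null_add) (use insert in auto)
  then show ?case using insert.hyps by (simp only: sum.insert not_False_eq_True)
qed (simp_all only: sum.infinite sum.empty not_False_eq_True null_0)

lemma translate_sum: "translate g (sum f I) = (\<Sum>i\<in>I. translate g (f i))"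
proof (induction I rule: infinite_finite_induct)
  case (insert i I)
  then show ?case by (simp only: sum.insert op_add not_False_eq_True)
qed (simp_all only: sum.infinite sum.empty not_False_eq_True op_zero)

lemma sum_const_scale: "(\<Sum>i\<in>I. F) = scale (of_nat (card I)) F"
proof (induction I rule: infinite_finite_induct)
  case (insert i I)
  have "F + scale (of_nat (card I)) F = scale (of_nat (Suc (card I))) F"
    by (simp add: fun_eq_iff distrib_right)
  then show ?case using insert by (simp only: sum.insert card_insert_disjoint not_False_eq_True)
qed (simp_all add: fun_eq_iff)

lemma null_translate_one: "null (translate \<one> F - F)"
  by (rule nullI_Z) simp

lemma cocycle_lift_of:
  assumes "cocycle1 G T H quot quot_act f" "h \<in> H"
  shows "lift_of (f h) \<in> gen_span" "quot_class (lift_of (f h)) = f h"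
  using assms lift_of by (simp_all add: cocycle1_def quot_simps)

lemma cocycle_mult:
  assumes H: "open_subgroup G T H" and f: "cocycle1 G T H quot quot_act f" and hk: "h \<in> H" "k \<in> H"
  shows "lift_of (f h) + translate h (lift_of (f k)) \<in> gen_span" "f (h \<otimes> k) = quot_class (lift_of (f h) + translate h (lift_of (f k)))"
proof -
  note lift_of_f = cocycle_lift_of[OF f] and HG = open_subgroupD(4)[OF H]
  show "lift_of (f h) + translate h (lift_of (f k)) \<in> gen_span"
    using hk by (intro gen_span_add gen_span_translate lift_of_f HG)
  have "f (h \<otimes> k) = f h \<otimes>\<^bsub>quot\<^esub> quot_act h (f k)"
    using f hk unfolding cocycle1_def by blast
  also have "\<dots> = quot_class (lift_of (f h)) \<otimes>\<^bsub>quot\<^esub> quot_class (translate h (lift_of (f k)))"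
    using lift_of_f(2)[OF hk(1)] by (simp add: quot_act_def)
  also have "\<dots> = quot_class (lift_of (f h) + translate h (lift_of (f k)))"
    by (rule mult_quot_class[OF lift_of_f(1)[OF hk(1)] gen_span_translate[OF lift_of_f(1)[OF hk(2)] HG[OF hk(1)]]])
  finally show "f (h \<otimes> k) = quot_class (lift_of (f h) + translate h (lift_of (f k)))" .
qed

lemma cocycle_one:
  assumes H: "open_subgroup G T H" and f: "cocycle1 G T H quot quot_act f"
  shows "f \<one> = quot_class 0"
proof -
  have 1: "\<one> \<in> H" by (rule open_subgroupD(3)[OF H])
  note lift_of_f = cocycle_lift_of[OF f 1] and f_mult = cocycle_mult[OF H f 1 1]
  have "quot_class (lift_of (f \<one>)) = quot_class (lift_of (f \<one>) + translate \<one> (lift_of (f \<one>)))"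
    using f_mult(2) lift_of_f(2) by simp
  then have "null (lift_of (f \<one>) - (lift_of (f \<one>) + translate \<one> (lift_of (f \<one>))))"
    using quot_class_eq[OF lift_of_f(1) f_mult(1)] by blast
  then have "null (- (lift_of (f \<one>) - (lift_of (f \<one>) + translate \<one> (lift_of (f \<one>)))) - (translate \<one> (lift_of (f \<one>)) - lift_of (f \<one>)))"
    by (rule null_diff[OF null_uminus null_translate_one])
  then have "null (lift_of (f \<one>) - 0)" by simp
  then show ?thesis using quot_class_eq[OF lift_of_f(1) gen_span_0] lift_of_f(2) by simp
qed

lemma cocycle_near:
  assumes H: "open_subgroup G T H" and f: "cocycle1 G T H quot quot_act f"
  shows "near (\<lambda>u. u \<in> H \<and> f u = quot_class 0)"
proof (rule nearI)
  show "openin T {h \<in> H. f h = quot_class 0}" using f unfolding cocycle1_def by blast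
qed (use cocycle_one[OF H f] open_subgroupD(3)[OF H] in auto)

text \<open>The image \<open>f ` H\<close> of a cocycle stands for the cosets of the kernel of \<open>f\<close>, on which
  left translation by \<open>h\<close> becomes the permutation \<open>v \<mapsto> f h + h v\<close>.\<close>
lemma cocycle_average:
  assumes H: "open_subgroup G T H" and f: "cocycle1 G T H quot quot_act f"
  shows "\<exists>n > 0. \<exists>m\<in>gen_span. \<forall>h\<in>H. null (scale (of_nat n) (lift_of (f h)) + translate h m - m)"
proof -
  note sub = open_subgroupD(1)[OF H] and HG = open_subgroupD(4)[OF H]
  note lift_of_f = cocycle_lift_of[OF f] and sumA = cocycle_mult(1)[OF H f] and f_mult = cocycle_mult(2)[OF H f]
  obtain R where R: "finite R" "R \<subseteq> carrier G"
    "\<forall>g\<in>carrier G. \<exists>x\<in>R. inv x \<otimes> g \<in> H \<and> f (inv x \<otimes> g) = quot_class 0"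
    using near_finite_cover[OF cocycle_near[OF H f]] by blast
  \<comment> \<open>The cocycle is constant on each translate of a neighbourhood where it vanishes,
    and finitely many translates cover \<open>H\<close>. So its image is finite.\<close>
  have "f ` H \<subseteq> f ` R"
  proof
    fix v assume "v \<in> f ` H"
    then obtain h where h: "h \<in> H" "v = f h" by blast
    obtain x where x: "x \<in> R" "inv x \<otimes> h \<in> H" "f (inv x \<otimes> h) = quot_class 0"
      using R(3) HG[OF h(1)] by blast
    have xG: "x \<in> carrier G" using x(1) R(2) by blast
    have "h \<otimes> inv (inv x \<otimes> h) \<in> H"
      by (intro subgroup.m_closed[OF sub] subgroup.m_inv_closed[OF sub] h(1) x(2))
    then have xH: "x \<in> H"
      using xG HG[OF h(1)] by (simp add: inv_mult_group m_assoc[symmetric])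
    have "x \<otimes> (inv x \<otimes> h) = h" using xG HG[OF h(1)] by (simp add: m_assoc[symmetric])
    then have eq: "f h = quot_class (lift_of (f x) + translate x (lift_of (quot_class 0)))"
      using f_mult[OF xH x(2)] x(3) by simp
    have "null (translate x (lift_of (quot_class 0) - 0))"
      by (rule null_translate[OF lift_of_quot_class(2)[OF gen_span_0] xG])
    then have "null (lift_of (f x) + translate x (lift_of (quot_class 0)) - lift_of (f x))"
      by (simp add: op_diff op_zero)
    then have "f h = f x"
      using eq quot_class_eq[of "lift_of (f x) + translate x (lift_of (quot_class 0))" "lift_of (f x)"] lift_of_f[OF xH] gen_span_0
      by (simp add: gen_span_add gen_span_translate xG lift_of_quot_class)
    then show "v \<in> f ` R" using h(2) x(1) by blast
  qed
  then have fin: "finite (f ` H)" using R(1) finite_surj by blast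
  define m where "m = (\<Sum>v\<in>f ` H. lift_of v)"
  have lfV: "lift_of v \<in> gen_span" if "v \<in> f ` H" for v using lift_of_f(1) that by blast
  have mA: "m \<in> gen_span" unfolding m_def by (rule gen_span_sum) (rule lfV)
  have "null (scale (of_nat (card (f ` H))) (lift_of (f h)) + translate h m - m)" if h: "h \<in> H" for h
  proof -
    define \<sigma> where "\<sigma> = (\<lambda>v. quot_class (lift_of (f h) + translate h (lift_of v)))"
    have sA: "lift_of (f h) + translate h (lift_of v) \<in> gen_span" if "v \<in> f ` H" for v
      using that sumA[OF h] by blast
    have sub_V: "\<sigma> ` f ` H \<subseteq> f ` H"
    proof
      fix w assume "w \<in> \<sigma> ` f ` H"
      then obtain k where k: "k \<in> H" "w = \<sigma> (f k)" by blast
      have "h \<otimes> k \<in> H" by (rule subgroup.m_closed[OF sub h k(1)])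
      then show "w \<in> f ` H" using f_mult[OF h k(1)] k(2) unfolding \<sigma>_def by (metis imageI)
    qed
    have inj: "inj_on \<sigma> (f ` H)"
    proof (rule inj_onI)
      fix v w assume vw: "v \<in> f ` H" "w \<in> f ` H" "\<sigma> v = \<sigma> w"
      then have "null ((lift_of (f h) + translate h (lift_of v)) - (lift_of (f h) + translate h (lift_of w)))"
        using quot_class_eq[OF sA[OF vw(1)] sA[OF vw(2)]] unfolding \<sigma>_def by blast
      then have "null (translate h (lift_of v - lift_of w))" by (simp add: op_diff)
      then have "null (translate (inv h) (translate h (lift_of v - lift_of w)))"
        by (rule null_translate) (use HG[OF h] in simp)
      then have "null (translate \<one> (lift_of v - lift_of w))"
        using HG[OF h] by (simp add: translate_mult[symmetric])
      then have "null (translate \<one> (lift_of v - lift_of w) - (translate \<one> (lift_of v - lift_of w) - (lift_of v - lift_of w)))"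
        by (intro null_diff null_translate_one)
      then have "null (lift_of v - lift_of w)" by simp
      then have "quot_class (lift_of v) = quot_class (lift_of w)" using quot_class_eq[OF lfV[OF vw(1)] lfV[OF vw(2)]] by blast
      then show "v = w" using vw lift_of_f(2) by auto
    qed
    \<comment> \<open>\<open>\<sigma>\<close> permutes the finite image, so the representatives of
      the \<open>\<sigma> v\<close> again sum to \<open>m\<close>. Comparing them termwise with f(h)
      + h v gives the relation modulo null functions.\<close>
    have "(\<Sum>v\<in>f ` H. lift_of (\<sigma> v)) = m"
      using sum.reindex[OF inj, of lift_of] endo_inj_surj[OF fin sub_V inj] by (simp add: m_def)
    then have "(\<Sum>v\<in>f ` H. lift_of (f h) + translate h (lift_of v) - lift_of (\<sigma> v))
        = scale (of_nat (card (f ` H))) (lift_of (f h)) + translate h m - m"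
      by (simp only: sum_subtractf sum.distrib sum_const_scale translate_sum m_def)
    moreover have "null (\<Sum>v\<in>f ` H. lift_of (f h) + translate h (lift_of v) - lift_of (\<sigma> v))"
    proof (rule null_sum)
      fix v assume "v \<in> f ` H"
      then have "null (- (lift_of (\<sigma> v) - (lift_of (f h) + translate h (lift_of v))))"
        unfolding \<sigma>_def by (intro null_uminus lift_of_quot_class sA)
      then show "null (lift_of (f h) + translate h (lift_of v) - lift_of (\<sigma> v))" by simp
    qed
    ultimately show ?thesis by simp
  qed
  moreover have "card (f ` H) > 0"
    using fin open_subgroupD(3)[OF H] by (auto simp: card_gt_0_iff)
  ultimately show ?thesis using mA by blast
qed

text \<open>The average shows that n f(h) = m - h m. Dividing -m by \<open>n\<close> gives m', and f
  minus the coboundary of m' is killed by \<open>n\<close>, hence lies in the torsion. There it is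
  an S-valued cocycle, which the trivialiser \<open>F\<close> bounds; so \<open>F + m'\<close>
  bounds \<open>f\<close>.\<close>

lemma H1_vanishes_quot:
  assumes H: "open_subgroup G T H"
  shows "H1_vanishes G T H quot quot_act"
  unfolding H1_vanishes_def
proof (intro allI impI)
  fix f assume f: "cocycle1 G T H quot quot_act f"
  note sub = open_subgroupD(1)[OF H] and HG = open_subgroupD(4)[OF H]
  note lift_of_f = cocycle_lift_of[OF f]
  obtain n m where n: "n > 0" and m: "m \<in> gen_span"
    "\<And>h. h \<in> H \<Longrightarrow> null (scale (of_nat n) (lift_of (f h)) + translate h m - m)"
    using cocycle_average[OF H f] by blast
  obtain k n' where kn: "n = nat p ^ k * n'" "n' > 0" "\<not> p dvd int n'"
    using nat_decompose[OF n] .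
  \<comment> \<open>Division of -m by \<open>n = p^k n'\<close>: the shift divides by
    \<open>p ^ k\<close>, and \<open>1 / n'\<close> lies in Z_(p).\<close>
  define m' where "m' = - scale (1 / of_nat n') (shift k m)"
  have m'A: "m' \<in> gen_span" unfolding m'_def by (intro gen_span_uminus gen_span_scale gen_span_shift m inverse_in_Z kn)
  have "scale (of_nat n) m' + m = - (scale (of_int p ^ k) (shift k m) - m)"
    using kn by (simp add: m'_def fun_eq_iff)
  then have nm': "null (scale (of_nat n) m' + m)"
    using null_uminus[OF null_scale_shift[OF gen_span_tower[OF m(1)], of k]] by simp
  define D where "D = (\<lambda>h. lift_of (f h) - (translate h m' - m'))"
  have DA: "D h \<in> gen_span" if "h \<in> H" for h
    unfolding D_def using that by (intro gen_span_diff gen_span_translate m'A lift_of_f HG)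
  have D_twist: "twisted (D h)" if h: "h \<in> H" for h
  proof -
    have "null ((scale (of_nat n) (lift_of (f h)) + translate h m - m) - translate h (scale (of_nat n) m' + m)
        + (scale (of_nat n) m' + m))"
      by (intro null_add null_diff null_translate m nm' h HG)
    then have "null (scale (of_nat n) (D h))"
      by (simp add: D_def op_diff op_add translate_scale algebra_simps)
    then show ?thesis
      using twisted_if_scale[OF gen_span_tower[OF DA[OF h]] _ n] unfolding null_def by blast
  qed
  \<comment> \<open>\<open>D h\<close> is twisted, so its class is determined by its value at the
    identity in level 0, which is its coordinate in Q/Z_(p).\<close>
  define c where "c = (\<lambda>h. D h \<one> 0)"
  have S_cocycle: "S_cocycle H c"
    unfolding S_cocycle_def
  proof (intro conjI ballI)
    fix h k assume hk: "h \<in> H" "k \<in> H"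
    have hkH: "h \<otimes> k \<in> H" by (rule subgroup.m_closed[OF sub hk])
    have "null (lift_of (f (h \<otimes> k)) - (lift_of (f h) + translate h (lift_of (f k))))"
      using lift_of_quot_class(2)[OF cocycle_mult(1)[OF H f hk]] cocycle_mult(2)[OF H f hk] by simp
    then have "null (D (h \<otimes> k) - (D h + translate h (D k)))"
      by (simp add: D_def translate_mult HG hk op_diff op_add algebra_simps)
    then have "D (h \<otimes> k) \<one> 0 - (D h \<one> 0 + D k h 0) \<in> Z"
      using HG[OF hk(1)] unfolding null_def by simp
    moreover have "D k h 0 - twist h (D k \<one> 0) \<in> Z"
      by (rule twistedD[OF D_twist[OF hk(2)] HG[OF hk(1)]])
    ultimately have "(D (h \<otimes> k) \<one> 0 - (D h \<one> 0 + D k h 0)) + (D k h 0 - twist h (D k \<one> 0)) \<in> Z"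
      by blast
    then show "c (h \<otimes> k) - (c h + twist h (c k)) \<in> Z"
      by (simp add: c_def algebra_simps)
  next
    show "near (\<lambda>h. h \<in> H \<and> c h \<in> Z)"
    proof (rule near_mono[OF near_conj[OF cocycle_near[OF H f] admissible_near[OF gen_span_admissible[OF m'A], of 0]]])
      fix h assume hG: "h \<in> carrier G"
        and a: "(h \<in> H \<and> f h = quot_class 0) \<and> (\<forall>x\<in>carrier G. m' (x \<otimes> h) 0 - m' x 0 \<in> Z)"
      have "m' (\<one> \<otimes> h) 0 - m' \<one> 0 \<in> Z" using a by blast
      then have "m' h 0 - m' \<one> 0 \<in> Z" using hG by simp
      moreover have "lift_of (quot_class 0) \<one> 0 \<in> Z"
        using lift_of_quot_class(2)[OF gen_span_0] unfolding null_def by simp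
      ultimately have "lift_of (quot_class 0) \<one> 0 - (m' h 0 - m' \<one> 0) \<in> Z" by blast
      then show "h \<in> H \<and> c h \<in> Z" using a hG by (simp add: c_def D_def)
    qed
  qed
  define F where "F = translate \<one> (trivialiser H c)"
  have FA: "F \<in> gen_span" unfolding F_def by (rule gen_span_trivialiser)
  have F_trivialiser: "F x i = trivialiser H c x i" if "x \<in> carrier G" for x i
    using that by (simp add: F_def)
  have "f h = quot_act h (quot_class (F + m')) \<otimes>\<^bsub>quot\<^esub> inv\<^bsub>quot\<^esub> (quot_class (F + m'))" if h: "h \<in> H" for h
  proof -
    have hG: "h \<in> carrier G" by (rule HG[OF h])
    have "twisted (translate h F - F)"
      by (rule twisted_cong[OF trivialiser_S_cocycle(2)[OF H S_cocycle h]]) (simp add: F_trivialiser hG)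
    then have "twisted (D h - (translate h F - F))" by (rule twisted_diff[OF D_twist[OF h]])
    moreover have "(D h - (translate h F - F)) \<one> 0 \<in> Z"
      using Z_uminus[OF trivialiser_S_cocycle(3)[OF H S_cocycle h]] hG by (simp add: c_def F_trivialiser)
    ultimately have "null (D h - (translate h F - F))" unfolding null_def by blast
    then have "null (lift_of (f h) - (translate h (F + m') + - (F + m')))"
      by (simp add: D_def op_add algebra_simps)
    then have "quot_class (lift_of (f h)) = quot_class (translate h (F + m') + - (F + m'))"
      using quot_class_eq[of "lift_of (f h)" "translate h (F + m') + - (F + m')"] lift_of_f(1)[OF h] FA m'A hG
        gen_span_add[OF gen_span_translate[OF gen_span_add[OF FA m'A] hG] gen_span_uminus[OF gen_span_add[OF FA m'A]]] by blast
    then show ?thesis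
      using lift_of_f(2)[OF h] mult_quot_class[OF gen_span_translate[OF gen_span_add[OF FA m'A] hG] gen_span_uminus[OF gen_span_add[OF FA m'A]]]
        act_quot_class[OF gen_span_add[OF FA m'A] hG] inv_quot_class[OF gen_span_add[OF FA m'A]] by (simp only:)
  qed
  then show "coboundary1 H quot quot_act f"
    unfolding coboundary1_def quot_simps using gen_span_add[OF FA m'A] by blast
qed

text \<open>The isomorphism of the torsion with S evaluates a representative at the identity in
  level 0. It is well defined and injective because a twisted function is null exactly when this
  value is integral.\<close>

lemma H90_module_quot: "H90_module p G T \<theta> quot quot_act"
  unfolding H90_module_def
proof (intro conjI allI impI ballI)
  define \<phi> where "\<phi> = (\<lambda>x. coset (lift_of x \<one> 0))"
  have phi: "\<phi> (quot_class F) = coset (F \<one> 0)" if "F \<in> gen_span" for F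
    unfolding \<phi>_def coset_eq using lift_of_quot_class(2)[OF that] unfolding null_def by simp
  show "\<exists>\<phi>. bij_betw \<phi> (p_primary p quot) (carrier (S_grp p))
    \<and> (\<forall>x\<in>p_primary p quot. \<forall>y\<in>p_primary p quot. \<phi> (x \<otimes>\<^bsub>quot\<^esub> y) = \<phi> x \<otimes>\<^bsub>S_grp p\<^esub> \<phi> y)
    \<and> (\<forall>g\<in>carrier G. \<forall>x\<in>p_primary p quot. \<phi> (quot_act g x) = S_act p \<theta> g (\<phi> x))"
  proof (intro exI conjI ballI)
    show "bij_betw \<phi> (p_primary p quot) (carrier (S_grp p))"
      unfolding bij_betw_def
    proof
      show "inj_on \<phi> (p_primary p quot)"
      proof (rule inj_onI)
        fix x y assume "x \<in> p_primary p quot" "y \<in> p_primary p quot" and eq: "\<phi> x = \<phi> y"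
        then obtain X Y where XY: "X \<in> gen_span" "twisted X" "x = quot_class X" "Y \<in> gen_span" "twisted Y" "y = quot_class Y"
          unfolding p_primary_quot by blast
        then have "null (X - Y)"
          using eq phi twisted_diff unfolding null_def by (simp add: coset_eq)
        then show "x = y" using XY quot_class_eq by simp
      qed
      show "\<phi> ` p_primary p quot = carrier (S_grp p)"
      proof (intro equalityI subsetI)
        fix A assume "A \<in> carrier (S_grp p)"
        then obtain q where q: "A = coset q" unfolding carrier_S by blast
        \<comment> \<open>The empty set is not a subgroup, so the trivialiser takes its default
          value \<open>base q\<close>; this provides a preimage of the class of
          \<open>q\<close>.\<close>
        define F where "F = translate \<one> (trivialiser {} (\<lambda>_. q))"
        have F: "F \<in> gen_span" unfolding F_def by (rule gen_span_trivialiser)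
        have "twisted F" unfolding F_def trivialiser_empty by (intro twisted_translate twisted_base one_closed)
        moreover have "\<phi> (quot_class F) = A"
          unfolding phi[OF F] q coset_eq using base_one by (simp add: F_def trivialiser_empty)
        ultimately show "A \<in> \<phi> ` p_primary p quot" using F unfolding p_primary_quot by blast
      qed (auto simp: carrier_S \<phi>_def)
    qed
    show "\<phi> (x \<otimes>\<^bsub>quot\<^esub> y) = \<phi> x \<otimes>\<^bsub>S_grp p\<^esub> \<phi> y"
      if x: "x \<in> p_primary p quot" and y: "y \<in> p_primary p quot" for x y
    proof -
      obtain X where X: "X \<in> gen_span" "x = quot_class X"
        using x unfolding p_primary_quot by blast
      obtain Y where Y: "Y \<in> gen_span" "y = quot_class Y"
        using y unfolding p_primary_quot by blast
      show ?thesis using X Y by (simp add: mult_quot_class phi gen_span_add mult_S)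
    qed
    show "\<phi> (quot_act g x) = S_act p \<theta> g (\<phi> x)" if g: "g \<in> carrier G" and x: "x \<in> p_primary p quot" for g x
    proof -
      obtain X where X: "X \<in> gen_span" "twisted X" "x = quot_class X"
        using x unfolding p_primary_quot by blast
      have "\<phi> (quot_act g x) = coset (X g 0)" using X g by (simp add: act_quot_class phi gen_span_translate)
      also have "\<dots> = coset (twist g (X \<one> 0))"
        unfolding coset_eq by (rule twistedD[OF X(2) g])
      finally show ?thesis using X g by (simp add: phi S_act_coset)
    qed
  qed
qed (use discrete_quot quot_divisible H1_vanishes_quot in auto)

end

section \<open>Lifting cocycles by means of a Hilbert 90 module\<close>

locale hilbert_90 = oriented p G T \<theta>
  for p :: int and G :: "('g, 'b) monoid_scheme" (structure) and T :: "'g topology"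
    and \<theta> :: "'g \<Rightarrow> nat \<Rightarrow> int" +
  fixes M :: "('m, 'c) monoid_scheme" and act
  assumes H90_mod: "H90_module p G T \<theta> M act"
begin

lemma discrete: "discrete_module G T M act"
  using H90_mod unfolding H90_module_def by blast

sublocale M: comm_group M
  using discrete unfolding discrete_module_def by blast

lemma act_closed [simp]: "g \<in> carrier G \<Longrightarrow> m \<in> carrier M \<Longrightarrow> act g m \<in> carrier M"
  and act_mult: "g \<in> carrier G \<Longrightarrow> h \<in> carrier G \<Longrightarrow> m \<in> carrier M \<Longrightarrow> act (g \<otimes> h) m = act g (act h m)"
  and act_add: "g \<in> carrier G \<Longrightarrow> m \<in> carrier M \<Longrightarrow> m' \<in> carrier M
    \<Longrightarrow> act g (m \<otimes>\<^bsub>M\<^esub> m') = act g m \<otimes>\<^bsub>M\<^esub> act g m'"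
  and act_id: "m \<in> carrier M \<Longrightarrow> act \<one> m = m"
  and act_open: "m \<in> carrier M \<Longrightarrow> openin T {g \<in> carrier G. act g m = m}"
  using discrete unfolding discrete_module_def by blast+

lemma act_one: "g \<in> carrier G \<Longrightarrow> act g \<one>\<^bsub>M\<^esub> = \<one>\<^bsub>M\<^esub>"
  using act_add[of g "\<one>\<^bsub>M\<^esub>" "\<one>\<^bsub>M\<^esub>"] by simp

lemma act_inv:
  assumes "g \<in> carrier G" "m \<in> carrier M"
  shows "act g (inv\<^bsub>M\<^esub> m) = inv\<^bsub>M\<^esub> (act g m)"
  using act_add[of g "inv\<^bsub>M\<^esub> m" m] act_one assms by (intro M.inv_equality[symmetric]) auto

lemma act_pow:
  assumes "g \<in> carrier G" "m \<in> carrier M"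
  shows "act g (m [^]\<^bsub>M\<^esub> (n :: nat)) = act g m [^]\<^bsub>M\<^esub> n"
  using assms by (induction n) (simp_all add: act_one act_add)

section \<open>The torsion of the given module as Q/Z_(p)\<close>

abbreviation P where "P \<equiv> p_primary p M"

definition S_iso :: "('m \<Rightarrow> rat set) \<Rightarrow> bool" where
  "S_iso \<phi> \<longleftrightarrow> bij_betw \<phi> P (carrier (S_grp p))
    \<and> (\<forall>x\<in>P. \<forall>y\<in>P. \<phi> (x \<otimes>\<^bsub>M\<^esub> y) = \<phi> x \<otimes>\<^bsub>S_grp p\<^esub> \<phi> y)
    \<and> (\<forall>g\<in>carrier G. \<forall>x\<in>P. \<phi> (act g x) = S_act p \<theta> g (\<phi> x))"

definition \<phi> where "\<phi> = (SOME \<phi>. S_iso \<phi>)"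

lemma \<phi>: "bij_betw \<phi> P (carrier (S_grp p))"
    "\<And>x y. x \<in> P \<Longrightarrow> y \<in> P \<Longrightarrow> \<phi> (x \<otimes>\<^bsub>M\<^esub> y) = \<phi> x \<otimes>\<^bsub>S_grp p\<^esub> \<phi> y"
    "\<And>g x. g \<in> carrier G \<Longrightarrow> x \<in> P \<Longrightarrow> \<phi> (act g x) = S_act p \<theta> g (\<phi> x)"
proof -
  have "\<exists>\<phi>. S_iso \<phi>"
    using H90_mod unfolding H90_module_def S_iso_def by blast
  then have "S_iso \<phi>" unfolding \<phi>_def by (rule someI_ex)
  then show "bij_betw \<phi> P (carrier (S_grp p))"
    "\<And>x y. x \<in> P \<Longrightarrow> y \<in> P \<Longrightarrow> \<phi> (x \<otimes>\<^bsub>M\<^esub> y) = \<phi> x \<otimes>\<^bsub>S_grp p\<^esub> \<phi> y"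
    "\<And>g x. g \<in> carrier G \<Longrightarrow> x \<in> P \<Longrightarrow> \<phi> (act g x) = S_act p \<theta> g (\<phi> x)"
    unfolding S_iso_def by blast+
qed

text \<open>The projection of the rationals to Q/Z_(p) followed by the inverse isomorphism: a
  homomorphism onto the \<open>p\<close>-primary torsion of \<open>M\<close> with kernel Z_(p).
  Calculations with torsion elements thereby become congruences of rationals.\<close>

definition \<psi> where "\<psi> q = inv_into P \<phi> (coset q)"

lemma \<psi>: "\<psi> q \<in> P" "\<phi> (\<psi> q) = coset q"
proof -
  have "coset q \<in> \<phi> ` P" using \<phi>(1) unfolding bij_betw_def carrier_S by blast
  then show "\<psi> q \<in> P" "\<phi> (\<psi> q) = coset q"
    unfolding \<psi>_def by (rule inv_into_into, rule f_inv_into_f)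
qed

lemma P_carrier: "x \<in> P \<Longrightarrow> x \<in> carrier M"
  unfolding p_primary_def by blast

lemma \<psi>_carrier [simp]: "\<psi> q \<in> carrier M"
  using P_carrier \<psi>(1) by blast

lemma \<psi>_eq: "\<psi> q = \<psi> r \<longleftrightarrow> q - r \<in> Z"
  using \<psi>(2) coset_eq unfolding \<psi>_def by metis

lemma P_eq_\<psi>: 
  assumes "x \<in> P" "\<phi> x = coset q"
  shows "x = \<psi> q"
  using assms \<psi>[of q] inj_onD[OF bij_betw_imp_inj_on[OF \<phi>(1)], of x "\<psi> q"] by simp

lemma P_ex_\<psi>:
  assumes "x \<in> P"
  shows "\<exists>q. x = \<psi> q"
proof -
  have "\<phi> x \<in> range coset"
    using bij_betw_apply[OF \<phi>(1) assms] unfolding carrier_S .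
  then show ?thesis using P_eq_\<psi>[OF assms] by auto
qed

lemma pow_level_mono:
  assumes "x \<in> carrier M" "x [^]\<^bsub>M\<^esub> (nat p ^ n) = \<one>\<^bsub>M\<^esub>" "n \<le> k"
  shows "x [^]\<^bsub>M\<^esub> (nat p ^ k) = \<one>\<^bsub>M\<^esub>"
proof -
  have "nat p ^ k = nat p ^ n * nat p ^ (k - n)" using assms(3) by (simp flip: power_add)
  then show ?thesis using assms(1,2) by (metis M.nat_pow_pow M.nat_pow_one)
qed

lemma P_mult:
  assumes "x \<in> P" "y \<in> P"
  shows "x \<otimes>\<^bsub>M\<^esub> y \<in> P"
proof -
  obtain n k where "x [^]\<^bsub>M\<^esub> (nat p ^ n) = \<one>\<^bsub>M\<^esub>" "y [^]\<^bsub>M\<^esub> (nat p ^ k) = \<one>\<^bsub>M\<^esub>"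
    and xy: "x \<in> carrier M" "y \<in> carrier M"
    using assms unfolding p_primary_def by blast
  then have "x [^]\<^bsub>M\<^esub> (nat p ^ max n k) = \<one>\<^bsub>M\<^esub>" "y [^]\<^bsub>M\<^esub> (nat p ^ max n k) = \<one>\<^bsub>M\<^esub>"
    using pow_level_mono by (meson max.cobounded1 max.cobounded2)+
  then have "(x \<otimes>\<^bsub>M\<^esub> y) [^]\<^bsub>M\<^esub> (nat p ^ max n k) = \<one>\<^bsub>M\<^esub>"
    using xy by (simp add: M.nat_pow_distrib)
  then show ?thesis using xy unfolding p_primary_def by blast
qed

lemma P_act:
  assumes "g \<in> carrier G" "x \<in> P"
  shows "act g x \<in> P"
proof -
  obtain n where "x [^]\<^bsub>M\<^esub> (nat p ^ n) = \<one>\<^bsub>M\<^esub>" "x \<in> carrier M"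
    using assms(2) unfolding p_primary_def by blast
  then show ?thesis
    using act_pow[OF assms(1), of x "nat p ^ n"] act_one assms(1) unfolding p_primary_def by auto
qed

lemma \<psi>_add: "\<psi> (q + r) = \<psi> q \<otimes>\<^bsub>M\<^esub> \<psi> r"
  by (rule P_eq_\<psi>[symmetric]) (simp_all add: P_mult \<psi> \<phi>(2) mult_S)

lemma \<psi>_act: "g \<in> carrier G \<Longrightarrow> act g (\<psi> q) = \<psi> (twist g q)"
  by (rule P_eq_\<psi>) (simp_all add: P_act \<psi> \<phi>(3) S_act_coset)

lemma \<psi>_0: "\<psi> 0 = \<one>\<^bsub>M\<^esub>"
  using \<psi>_add[of 0 0] by simp

lemma \<psi>_eq_one: "\<psi> q = \<one>\<^bsub>M\<^esub> \<longleftrightarrow> q \<in> Z"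
  using \<psi>_eq[of q 0] by (simp add: \<psi>_0)

lemma \<psi>_pow: "\<psi> q [^]\<^bsub>M\<^esub> (n :: nat) = \<psi> (of_nat n * q)"
proof (induction n)
  case (Suc n)
  have "of_nat (Suc n) * q = of_nat n * q + q" by (simp add: algebra_simps)
  then show ?case using Suc \<psi>_add by simp
qed (simp add: \<psi>_0)

lemma of_nat_p: "of_nat (nat p ^ n) = (of_int p ^ n :: rat)"
  by simp

lemma p_power_divisible:
  assumes "m \<in> carrier M"
  shows "\<exists>x\<in>carrier M. x [^]\<^bsub>M\<^esub> (nat p ^ n) = m"
proof (induction n)
  case (Suc n)
  then obtain x where x: "x \<in> carrier M" "x [^]\<^bsub>M\<^esub> (nat p ^ n) = m" by blast
  obtain y where y: "y \<in> carrier M" "y [^]\<^bsub>M\<^esub> nat p = x"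
    using H90_mod x(1) unfolding H90_module_def by blast
  have "y [^]\<^bsub>M\<^esub> (nat p ^ Suc n) = m"
    using x y M.nat_pow_pow[OF y(1), of "nat p" "nat p ^ n"] by simp
  then show ?case using y by blast
qed (use assms in auto)

section \<open>Lifting through the given module\<close>

lemma cocycle_to_M:
  assumes H: "open_subgroup G T H" and c: "S_cocycle H c"
  shows "cocycle1 G T H M act (\<lambda>h. \<psi> (c h))"
  unfolding cocycle1_def
proof (intro conjI ballI allI)
  fix h k assume hk: "h \<in> H" "k \<in> H"
  have "\<psi> (c (h \<otimes> k)) = \<psi> (c h + twist h (c k))"
    unfolding \<psi>_eq by (rule cocycD[OF c hk])
  then show "\<psi> (c (h \<otimes> k)) = \<psi> (c h) \<otimes>\<^bsub>M\<^esub> act h (\<psi> (c k))"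
    using open_subgroupD(4)[OF H hk(1)] by (simp add: \<psi>_add \<psi>_act)
next
  fix m
  show "openin T {h \<in> H. \<psi> (c h) = m}"
  proof (cases "\<exists>q. m = \<psi> q")
    case True
    then obtain q where "m = \<psi> q" by blast
    then show ?thesis using S_cocycle_openin[OF H c, of q] by (simp add: \<psi>_eq)
  next
    case False
    then have "{h \<in> H. \<psi> (c h) = m} = {}" by blast
    then show ?thesis by (simp only: openin_empty)
  qed
qed simp

text \<open>The counterpart of \<open>H90_lift\<close>, now drawn from vanishing cohomology and
  divisibility of \<open>M\<close>: the coboundary of an element m' with \<open>p ^ n\<close> times
  m' equal to \<open>m\<close> is the required lift.\<close>

lemma cocycle_lift:
  assumes H: "open_subgroup G T H" and c: "S_cocycle H c" and pc: "\<And>h. h \<in> H \<Longrightarrow> of_int p * c h \<in> Z"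
  shows "\<exists>r. S_cocycle H r \<and> (\<forall>h\<in>H. of_int p ^ n * r h - c h \<in> Z)"
proof -
  note sub = open_subgroupD(1)[OF H] and HG = open_subgroupD(4)[OF H]
  have "coboundary1 H M act (\<lambda>h. \<psi> (c h))"
    using H90_mod H cocycle_to_M[OF H c] unfolding H90_module_def H1_vanishes_def by blast
  then obtain m where m: "m \<in> carrier M" "\<And>h. h \<in> H \<Longrightarrow> \<psi> (c h) = act h m \<otimes>\<^bsub>M\<^esub> inv\<^bsub>M\<^esub> m"
    unfolding coboundary1_def by blast
  obtain m' where m': "m' \<in> carrier M" "m' [^]\<^bsub>M\<^esub> (nat p ^ n) = m"
    using p_power_divisible[OF m(1)] by blast
  define g where "g = (\<lambda>h. act h m' \<otimes>\<^bsub>M\<^esub> inv\<^bsub>M\<^esub> m')"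
  have gM: "g h \<in> carrier M" if "h \<in> H" for h
    using that m' HG by (simp add: g_def)
  have g_pow: "g h [^]\<^bsub>M\<^esub> (nat p ^ n) = \<psi> (c h)" if h: "h \<in> H" for h
  proof -
    have "g h [^]\<^bsub>M\<^esub> (nat p ^ n) = act h m \<otimes>\<^bsub>M\<^esub> inv\<^bsub>M\<^esub> m"
      using m' HG[OF h] act_pow[OF HG[OF h] m'(1), of "nat p ^ n"]
      by (simp add: g_def M.nat_pow_distrib M.nat_pow_inv)
    then show ?thesis using m(2)[OF h] by simp
  qed
  \<comment> \<open>The \<open>p ^ n\<close>-multiple of \<open>g h\<close> is
    \<open>\<psi> (c h)\<close>, which \<open>p\<close> kills. So \<open>g h\<close> is killed by
    \<open>p ^ Suc n\<close> and has a rational representative.\<close>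
  have "g h \<in> P" if h: "h \<in> H" for h
  proof -
    have "g h [^]\<^bsub>M\<^esub> (nat p ^ Suc n) = \<psi> (c h) [^]\<^bsub>M\<^esub> nat p"
      using M.nat_pow_pow[OF gM[OF h], of "nat p ^ n" "nat p"] g_pow[OF h] by (simp add: mult.commute)
    also have "\<dots> = \<psi> (of_int p * c h)"
      unfolding \<psi>_pow using of_nat_p[of 1] by simp
    also have "\<dots> = \<one>\<^bsub>M\<^esub>" using pc[OF h] by (simp add: \<psi>_eq_one)
    finally show ?thesis using gM[OF h] unfolding p_primary_def by blast
  qed
  then have "\<forall>h\<in>H. \<exists>q. g h = \<psi> q" by (intro ballI P_ex_\<psi>)
  from bchoice[OF this] obtain r where r: "\<And>h. h \<in> H \<Longrightarrow> g h = \<psi> (r h)" by blast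
  have "S_cocycle H r"
    unfolding S_cocycle_def
  proof (intro conjI ballI)
    fix h k assume hk: "h \<in> H" "k \<in> H"
    have hkH: "h \<otimes> k \<in> H" by (rule subgroup.m_closed[OF sub hk])
    have "g (h \<otimes> k) = g h \<otimes>\<^bsub>M\<^esub> act h (g k)"
    proof -
      have "act h (g k) = act h (act k m') \<otimes>\<^bsub>M\<^esub> inv\<^bsub>M\<^esub> (act h m')"
        using hk HG m' by (simp add: g_def act_add act_inv)
      then have "g h \<otimes>\<^bsub>M\<^esub> act h (g k)
          = act h m' \<otimes>\<^bsub>M\<^esub> inv\<^bsub>M\<^esub> m' \<otimes>\<^bsub>M\<^esub> (act h (act k m') \<otimes>\<^bsub>M\<^esub> inv\<^bsub>M\<^esub> (act h m'))"
        by (simp add: g_def)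
      also have "\<dots> = act h (act k m') \<otimes>\<^bsub>M\<^esub> inv\<^bsub>M\<^esub> m' \<otimes>\<^bsub>M\<^esub> (act h m' \<otimes>\<^bsub>M\<^esub> inv\<^bsub>M\<^esub> (act h m'))"
        using hk HG m' by (simp only: M.m_ac M.m_closed M.inv_closed act_closed)
      also have "\<dots> = g (h \<otimes> k)"
        using hk HG m' by (simp add: g_def act_mult)
      finally show ?thesis by simp
    qed
    then have "\<psi> (r (h \<otimes> k)) = \<psi> (r h + twist h (r k))"
      using r hk hkH HG by (simp add: \<psi>_add \<psi>_act)
    then show "r (h \<otimes> k) - (r h + twist h (r k)) \<in> Z" by (simp add: \<psi>_eq)
  next
    \<comment> \<open>Continuity of the lift comes from the open stabiliser of m', on which its
      coboundary vanishes.\<close>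
    have "near (\<lambda>h. h \<in> H)" "near (\<lambda>h. act h m' = m')"
      using open_subgroupD(2,3)[OF H] act_open[OF m'(1)] act_id[OF m'(1)]
      by (auto intro: nearI[of H] nearI[of "{g \<in> carrier G. act g m' = m'}"])
    then have "near (\<lambda>h. h \<in> H \<and> act h m' = m')" by (rule near_conj)
    then show "near (\<lambda>h. h \<in> H \<and> r h \<in> Z)"
    proof (rule near_mono)
      fix h assume h: "h \<in> H \<and> act h m' = m'"
      then have "\<psi> (r h) = \<one>\<^bsub>M\<^esub>" using r[of h] m' by (simp add: g_def)
      then show "h \<in> H \<and> r h \<in> Z" using h by (simp add: \<psi>_eq_one)
    qed
  qed
  moreover have "of_int p ^ n * r h - c h \<in> Z" if h: "h \<in> H" for h
  proof -
    have "\<psi> (of_int p ^ n * r h) = \<psi> (c h)"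
      using g_pow[OF h] unfolding r[OF h] \<psi>_pow of_nat_p .
    then show ?thesis by (simp add: \<psi>_eq)
  qed
  ultimately show ?thesis by blast
qed

text \<open>Reduction from level \<open>n\<close> to level 1 is multiplication by p^(n-1), so
  \<open>cocycle_lift\<close> is applied with exponent \<open>m = n - 1\<close>. The lift so
  obtained reduces to \<open>c\<close> exactly, and the coboundary is that of 0.\<close>

lemma formal_H90: "formal_H90 p G T \<theta>"
  unfolding formal_H90_def
proof (intro allI impI)
  fix H n c
  assume Hn: "open_subgroup G T H \<and> n \<ge> (1 :: nat)"
    and c: "cocycle1 G T H (Zmod p 1) (Zmod_act p 1 \<theta>) c"
  then have H: "open_subgroup G T H" by blast
  obtain m where m: "n = Suc m" using Hn by (cases n) auto
  have cc: "S_cocycle H (\<lambda>h. of_int (c h) / of_int p)"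
    using S_cocycle_of_Zmod[OF H c] by simp
  obtain r where r: "S_cocycle H r" "\<And>h. h \<in> H \<Longrightarrow> of_int p ^ m * r h - of_int (c h) / of_int p \<in> Z"
    using cocycle_lift[OF H cc, of m] by auto
  have "of_int p ^ n * r h \<in> Z" if "h \<in> H" for h
  proof -
    have "of_int p ^ 1 * (of_int p ^ m * r h - of_int (c h) / of_int p) + of_int (c h) \<in> Z"
      using Z_add[OF Z_mult[OF Z_p r(2)[OF that]] Z_simps(1)] .
    then show ?thesis unfolding m by (simp add: algebra_simps)
  qed
  then obtain c' where c': "cocycle1 G T H (Zmod p n) (Zmod_act p n \<theta>) c'"
    "\<And>h. h \<in> H \<Longrightarrow> r h - of_int (c' h) / of_int p ^ n \<in> Z"
    using Zmod_of_S_cocycle[OF H r(1), of n] by blast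
  have "(c' h - c h) mod p = 0" if h: "h \<in> H" for h
  proof -
    have "(of_int p ^ m * r h - of_int (c h) / of_int p)
        - of_int p ^ m * (r h - of_int (c' h) / of_int p ^ n) \<in> Z"
      by (intro Z_diff r(2) Z_mult Z_p c'(2) h)
    moreover have "of_int p ^ m * (of_int (c' h) / of_int p ^ n) = (of_int (c' h) / of_int p :: rat)"
      unfolding m by simp
    ultimately have "of_int (c' h - c h) / of_int p ^ 1 \<in> Z"
      by (simp add: right_diff_distrib diff_divide_distrib)
    then show ?thesis unfolding Z_of_int_div by simp
  qed
  moreover have "Zmod_act p 1 \<theta> h 0 \<otimes>\<^bsub>Zmod p 1\<^esub> inv\<^bsub>Zmod p 1\<^esub> 0 = 0" for h
    using inv_Zmod[OF p_gt_0, of 0 1] by (simp add: Zmod_def Zmod_act_def)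
  moreover have "0 \<in> carrier (Zmod p 1)" by (simp add: Zmod_def)
  ultimately have "coboundary1 H (Zmod p 1) (Zmod_act p 1 \<theta>) (\<lambda>h. (c' h - c h) mod p)"
    unfolding coboundary1_def by (intro bexI[of _ 0]) auto
  then show "\<exists>c'. cocycle1 G T H (Zmod p n) (Zmod_act p n \<theta>) c'
      \<and> coboundary1 H (Zmod p 1) (Zmod_act p 1 \<theta>) (\<lambda>h. (c' h - c h) mod p)"
    using c'(1) by blast
qed

end

text \<open>The existential quantifier ranges over structures on one type, so the carrier type of
  the witness has to be named; \<open>'g set \<times> nat\<close> is large enough for
  \<open>gen_span\<close>. The converse holds for modules on an arbitrary type
  \<open>'m\<close>.\<close>

theorem theorem1p5:
  fixes p :: int and G :: "('g, 'b) monoid_scheme" and T :: "'g topology"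
    and \<theta> :: "'g \<Rightarrow> nat \<Rightarrow> int"
  assumes "prime p" and "profinite_group G T" and "p_orientation p G T \<theta>"
  shows "(formal_H90 p G T \<theta> \<longrightarrow>
            (\<exists>(M :: ('g set \<times> nat) monoid) act. H90_module p G T \<theta> M act))
       \<and> (\<forall>(M :: 'm monoid) act. H90_module p G T \<theta> M act \<longrightarrow> formal_H90 p G T \<theta>)"
proof -
  interpret oriented p G T \<theta> by standard (use assms in auto)
  show ?thesis
  proof (intro conjI impI allI)
    assume "formal_H90 p G T \<theta>"
    then interpret oriented_H90 p G T \<theta> by unfold_locales
    show "\<exists>(M :: ('g set \<times> nat) monoid) act. H90_module p G T \<theta> M act"
      using H90_module_quot by blast
  next
    fix M :: "'m monoid" and act
    assume "H90_module p G T \<theta> M act"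
    then interpret M: hilbert_90 p G T \<theta> M act by unfold_locales
    show "formal_H90 p G T \<theta>" by (rule M.formal_H90)
  qed
qed

end
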